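(* Let $R$ be an associative ring with $1$, let $n\ge 4$, and let $A,B,C,D$ be two-sided ideals of $R$. Then $$\big[\big[E(n,A),E(n,B)\big],\big[E(n,C),E(n,D)\big]\big]=\big[E(n,A\circ B),E(n,C\circ D)\big].$$
   Context: Rings are associative with $1$, not necessarily commutative. For $1\le i\ne j\le n$ and $c\in R$, the elementary transvection is $t_{ij}(c)=e+c\,e_{ij}\in \mathrm{GL}(n,R)$, where $e$ is the identity matrix and $e_{ij}$ the standard matrix unit. For a two-sided ideal $A$ of $R$, the (unrelative) elementary subgroup of level $A$ is $E(n,A)=\langle t_{ij}(a) : 1\le i\ne j\le n,\ a\in A\rangle\le \mathrm{GL}(n,R)$. For two-sided ideals $A,B$ of $R$, $AB$ is the two-sided ideal additively generated by the products $ab$, $a\in A$, $b\in B$, and $A\circ B=AB+BA$ is the symmetrised product. For elements $x,y$ of a group, $[x,y]=xyx^{-1}y^{-1}$. For subgroups $F,H$ of a group, $[F,H]$ is the subgroup generated by all $[f,h]$ with $f\in F$, $h\in H$. *)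

theory Defs
  imports "HOL-Algebra.Algebra"
begin

text \<open>Square matrices of size \<open>n\<close> over \<open>R\<close> are extensional functions on pairs of indices
  from \<open>{1..n}\<close>, so that equality of matrices is equality of functions.\<close>

definition matrix_monoid :: "('a, 'b) ring_scheme \<Rightarrow> nat \<Rightarrow> (nat \<times> nat \<Rightarrow> 'a) monoid" where
  "matrix_monoid R n =
     \<lparr>carrier = ({1..n} \<times> {1..n}) \<rightarrow>\<^sub>E carrier R,
      monoid.mult = (\<lambda>M N. \<lambda>(i, j) \<in> {1..n} \<times> {1..n}. \<Oplus>\<^bsub>R\<^esub>k\<in>{1..n}. M (i, k) \<otimes>\<^bsub>R\<^esub> N (k, j)),
      one = (\<lambda>(i, j) \<in> {1..n} \<times> {1..n}. if i = j then \<one>\<^bsub>R\<^esub> else \<zero>\<^bsub>R\<^esub>)\<rparr>"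

definition GL :: "nat \<Rightarrow> ('a, 'b) ring_scheme \<Rightarrow> (nat \<times> nat \<Rightarrow> 'a) monoid" where
  "GL n R = units_of (matrix_monoid R n)"

definition transvection ::
    "('a, 'b) ring_scheme \<Rightarrow> nat \<Rightarrow> nat \<Rightarrow> nat \<Rightarrow> 'a \<Rightarrow> (nat \<times> nat \<Rightarrow> 'a)" where
  "transvection R n i j c =
     (\<lambda>(k, l) \<in> {1..n} \<times> {1..n}.
        (if k = l then \<one>\<^bsub>R\<^esub> else \<zero>\<^bsub>R\<^esub>) \<oplus>\<^bsub>R\<^esub> (if k = i \<and> l = j then c else \<zero>\<^bsub>R\<^esub>))"

definition elementary_subgroup ::
    "('a, 'b) ring_scheme \<Rightarrow> nat \<Rightarrow> 'a set \<Rightarrow> (nat \<times> nat \<Rightarrow> 'a) set" where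
  "elementary_subgroup R n A =
     generate (GL n R)
       {transvection R n i j a | i j a. i \<in> {1..n} \<and> j \<in> {1..n} \<and> i \<noteq> j \<and> a \<in> A}"

text \<open>The library's \<open>ideal_prod\<close> is the set of nonempty finite sums of products \<open>a b\<close>, which for
  two-sided ideals is already a two-sided ideal.\<close>

definition symm_prod :: "('a, 'b) ring_scheme \<Rightarrow> 'a set \<Rightarrow> 'a set \<Rightarrow> 'a set" where
  "symm_prod R A B = ideal_prod R A B <+>\<^bsub>R\<^esub> ideal_prod R B A"

definition commutator :: "('a, 'b) monoid_scheme \<Rightarrow> 'a \<Rightarrow> 'a \<Rightarrow> 'a" where
  "commutator G x y = x \<otimes>\<^bsub>G\<^esub> y \<otimes>\<^bsub>G\<^esub> inv\<^bsub>G\<^esub> x \<otimes>\<^bsub>G\<^esub> inv\<^bsub>G\<^esub> y"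

definition commutator_subgroup ::
    "('a, 'b) monoid_scheme \<Rightarrow> 'a set \<Rightarrow> 'a set \<Rightarrow> 'a set" where
  "commutator_subgroup G F H = generate G {commutator G f h | f h. f \<in> F \<and> h \<in> H}"

end

theory Submission
  imports Defs
begin

text \<open>
  Write \<open>I = A \<circ> B\<close>, \<open>J = C \<circ> D\<close> and let \<open>E(R, I)\<close> be the normal closure of \<open>E(n, I)\<close> in the elementary
  group \<open>E(n, R)\<close>. Only the Steinberg relations are used. By Vaserstein and Suslin, \<open>E(R, I)\<close> is generated
  by the conjugates of \<open>t\<^sub>i\<^sub>j(x)\<close>, \<open>x \<in> I\<close>, by \<open>t\<^sub>j\<^sub>i(c)\<close>, and for a product \<open>x = ab\<close> or \<open>x = ba\<close> these
  visibly lie in \<open>[E(n, A), E(n, B)]\<close>. Modulo \<open>E(R, I)\<close> the elementary commutators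
  \<open>y\<^sub>i\<^sub>j(a, b) = [t\<^sub>i\<^sub>j(a), t\<^sub>j\<^sub>i(b)]\<close> are central in \<open>E(n, R)\<close>, do not depend on \<open>(i, j)\<close>, and generate
  \<open>[E(n, A), E(n, B)]\<close>. Hence mixed commutator subgroups are normal in \<open>E(n, R)\<close>; in particular so is
  \<open>N = [E(n, I), E(n, J)]\<close>, which moreover contains \<open>[E(R, I), E(R, J)]\<close>. Since \<open>n \<ge> 4\<close>, one can move
  \<open>y\<^sub>k\<^sub>l(c, d)\<close> to indices disjoint from any given pair \<open>{i, j}\<close>, where it commutes with \<open>t\<^sub>i\<^sub>j(x)\<close> and
  \<open>y\<^sub>i\<^sub>j(a, b)\<close>, so all remaining commutators of generators are trivial modulo \<open>N\<close>.
\<close>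

section \<open>Commutators modulo a normal subgroup\<close>

text \<open>Quotients serve as abstract groups below; unfolding their operations into products of
  cosets would keep the group laws of \<open>G Mod N\<close> from applying.\<close>

declare mult_FactGroup [simp del] one_FactGroup [simp del]

lemma (in group_hom) hom_commutator:
  "\<lbrakk>x \<in> carrier G; y \<in> carrier G\<rbrakk> \<Longrightarrow> h (commutator G x y) = commutator H (h x) (h y)"
  by (simp add: commutator_def)

context group
begin

definition conjg :: "'a \<Rightarrow> 'a \<Rightarrow> 'a" where
  "conjg g x = g \<otimes> x \<otimes> inv g"

text \<open>For normal \<open>N\<close> and \<open>S\<close> inside the carrier, this is the
  preimage in \<open>G\<close> of the centraliser of the image of \<open>S\<close> in
  \<open>G Mod N\<close>.\<close>

definition cent :: "'a set \<Rightarrow> 'a set \<Rightarrow> 'a set" where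
  "cent N S = {x \<in> carrier G. \<forall>s\<in>S. commutator G x s \<in> N}"

lemma inv_mult_cancel:
  assumes "x \<in> carrier G" "y \<in> carrier G"
  shows "inv x \<otimes> (x \<otimes> y) = y" "x \<otimes> (inv x \<otimes> y) = y"
  using assms by (simp_all flip: m_assoc)

text \<open>Turns conjugates and commutators into right-associated words with inverses on single
  letters and cancels neighbours, so that identities valid in every group close by
  simplification.\<close>

lemmas word_simps = conjg_def commutator_def m_assoc inv_mult_group inv_mult_cancel

lemma conjg_closed [simp]: "g \<in> carrier G \<Longrightarrow> x \<in> carrier G \<Longrightarrow> conjg g x \<in> carrier G"
  by (simp add: conjg_def)

lemma commutator_closed [simp]:
  "x \<in> carrier G \<Longrightarrow> y \<in> carrier G \<Longrightarrow> commutator G x y \<in> carrier G"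
  by (simp add: commutator_def)

lemma conjg_mult:
  assumes "g \<in> carrier G" "x \<in> carrier G" "y \<in> carrier G"
  shows "conjg g (x \<otimes> y) = conjg g x \<otimes> conjg g y"
  using assms by (simp add: word_simps)

lemma conjg_conjg:
  assumes "g \<in> carrier G" "h \<in> carrier G" "x \<in> carrier G"
  shows "conjg g (conjg h x) = conjg (g \<otimes> h) x"
  using assms by (simp add: word_simps)

lemma conjg_inv:
  assumes "g \<in> carrier G" "x \<in> carrier G"
  shows "conjg g (inv x) = inv (conjg g x)"
  using assms by (simp add: word_simps)

lemma conjg_one [simp]: "g \<in> carrier G \<Longrightarrow> conjg g \<one> = \<one>" "x \<in> carrier G \<Longrightarrow> conjg \<one> x = x"
  by (simp_all add: conjg_def)

lemma conjg_inv_cancel: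
  assumes "g \<in> carrier G" "x \<in> carrier G"
  shows "conjg g (conjg (inv g) x) = x" "conjg (inv g) (conjg g x) = x"
  using assms by (simp_all add: conjg_conjg)

lemma conjg_commutator:
  assumes "g \<in> carrier G" "x \<in> carrier G" "y \<in> carrier G"
  shows "conjg g (commutator G x y) = commutator G (conjg g x) (conjg g y)"
  using assms by (simp add: word_simps)

lemma conjg_eq: "g \<in> carrier G \<Longrightarrow> x \<in> carrier G \<Longrightarrow> conjg g x = commutator G g x \<otimes> x"
  by (simp add: word_simps)

lemma commutator_swap:
  "x \<in> carrier G \<Longrightarrow> y \<in> carrier G \<Longrightarrow> commutator G y x = inv (commutator G x y)"
  by (simp add: word_simps)

lemma commutator_eq_one_iff:
  assumes "x \<in> carrier G" "y \<in> carrier G"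
  shows "commutator G x y = \<one> \<longleftrightarrow> x \<otimes> y = y \<otimes> x"
proof -
  have "commutator G x y = (x \<otimes> y) \<otimes> inv (y \<otimes> x)"
    using assms by (simp add: word_simps)
  then show ?thesis
    using assms by (metis inv_closed inv_equality inv_inv m_closed r_inv)
qed

lemma commutator_mult_left:
  assumes "x \<in> carrier G" "y \<in> carrier G" "s \<in> carrier G"
  shows "commutator G (x \<otimes> y) s = conjg x (commutator G y s) \<otimes> commutator G x s"
  using assms by (simp add: word_simps)

lemma commutator_inv_left:
  assumes "x \<in> carrier G" "s \<in> carrier G"
  shows "commutator G (inv x) s = conjg (inv x) (inv (commutator G x s))"
  using assms by (simp add: word_simps)

lemma commutator_sym_mem:
  assumes "subgroup N G" "x \<in> carrier G" "y \<in> carrier G" "commutator G x y \<in> N"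
  shows "commutator G y x \<in> N"
  using subgroup.m_inv_closed[OF assms(1,4)] assms(2,3) by (simp add: commutator_swap[of x y])

lemma conjg_mem_normal: "N \<lhd> G \<Longrightarrow> g \<in> carrier G \<Longrightarrow> x \<in> N \<Longrightarrow> conjg g x \<in> N"
  by (simp add: conjg_def normal.inv_op_closed2)

lemma commutator_mem_normal:
  assumes "N \<lhd> G" "x \<in> N" "y \<in> carrier G"
  shows "commutator G x y \<in> N" "commutator G y x \<in> N"
proof -
  interpret N: normal N G by fact
  have "commutator G x y = x \<otimes> conjg y (inv x)"
    using assms by (simp add: word_simps)
  then show "commutator G x y \<in> N"
    using assms by (simp add: conjg_mem_normal)
  then show "commutator G y x \<in> N"
    using assms N.subgroup_axioms commutator_sym_mem by auto
qed

text \<open>[xy, s] is a conjugate of [y, s] times [x, s], and normality of \<open>N\<close> absorbs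
  the conjugation.\<close>

lemma cent_subgroup:
  assumes "N \<lhd> G" "S \<subseteq> carrier G"
  shows "subgroup (cent N S) G"
proof -
  interpret N: normal N G by fact
  show ?thesis
  proof (rule subgroupI)
    have "\<one> \<in> cent N S"
      using assms(2) by (auto simp: cent_def word_simps subset_iff)
    then show "cent N S \<noteq> {}" by blast
  qed (use assms in \<open>auto simp: cent_def subset_iff commutator_mult_left commutator_inv_left
         intro!: conjg_mem_normal N.m_closed\<close>)
qed

text \<open>The conjugation moves to the other entry: [g x g^-1, s] is the conjugate by g of
  [x, g^-1 s g]. Normality of \<open>cent N S\<close> later allows membership to be tested on normal
  generators only.\<close>

lemma cent_normal:
  assumes "N \<lhd> G" "S \<subseteq> carrier G"
    and "\<And>g s. g \<in> carrier G \<Longrightarrow> s \<in> S \<Longrightarrow> conjg g s \<in> S"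
  shows "cent N S \<lhd> G"
proof (rule normal_invI)
  show "subgroup (cent N S) G"
    using assms by (simp add: cent_subgroup)
  fix g x assume g: "g \<in> carrier G" and x: "x \<in> cent N S"
  have "commutator G (conjg g x) s \<in> N" if s: "s \<in> S" for s
  proof -
    have "commutator G (conjg g x) s = conjg g (commutator G x (conjg (inv g) s))"
      using g x s assms(2) by (auto simp: cent_def subset_iff conjg_commutator conjg_inv_cancel)
    then show ?thesis
      using g x s assms by (auto simp: cent_def intro!: conjg_mem_normal)
  qed
  then show "g \<otimes> x \<otimes> inv g \<in> cent N S"
    using g x by (auto simp: cent_def simp flip: conjg_def)
qed

text \<open>Centralising modulo \<open>N\<close> is a symmetric relation, as [s, t] is inverse to
  [t, s]. This permits reduction to generators in either entry.\<close>

lemma cent_swap: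
  assumes N: "subgroup N G" and S: "S \<subseteq> carrier G" and "T \<subseteq> cent N S"
  shows "S \<subseteq> cent N T"
proof
  fix s assume s: "s \<in> S"
  have "commutator G s t \<in> N" if "t \<in> T" for t
    using that s assms(3) S by (intro commutator_sym_mem[OF N, of t s]) (auto simp: cent_def)
  then show "s \<in> cent N T"
    using s S by (auto simp: cent_def)
qed

text \<open>The subgroup property of \<open>cent\<close> settles the left entry; after a swap it
  settles the right one.\<close>

lemma commutator_generate_mem:
  assumes N: "N \<lhd> G" and ST: "S \<subseteq> carrier G" "T \<subseteq> carrier G"
    and comm: "\<And>x y. x \<in> S \<Longrightarrow> y \<in> T \<Longrightarrow> commutator G x y \<in> N"
    and "x \<in> generate G S" "y \<in> generate G T"
  shows "commutator G x y \<in> N"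
proof -
  have sub: "subgroup N G"
    using N normal_imp_subgroup by blast
  have "S \<subseteq> cent N T"
    using comm ST by (auto simp: cent_def)
  then have "generate G S \<subseteq> cent N T"
    using N ST by (intro generate_subgroup_incl cent_subgroup)
  then have "T \<subseteq> cent N (generate G S)"
    by (rule cent_swap[OF sub ST(2)])
  then have "generate G T \<subseteq> cent N (generate G S)"
    using N ST by (intro generate_subgroup_incl cent_subgroup generate_incl)
  then have "commutator G y x \<in> N"
    using assms(5,6) by (auto simp: cent_def)
  then show ?thesis
    using sub assms(5,6) ST commutator_sym_mem generate_in_carrier by blast
qed

lemma commutator_subgroup_subset:
  assumes "subgroup N G" "\<And>x y. x \<in> S \<Longrightarrow> y \<in> T \<Longrightarrow> commutator G x y \<in> N"
  shows "commutator_subgroup G S T \<subseteq> N"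
  unfolding commutator_subgroup_def using assms by (intro generate_subgroup_incl) auto

lemma commutator_subgroup_incl:
  "x \<in> S \<Longrightarrow> y \<in> T \<Longrightarrow> commutator G x y \<in> commutator_subgroup G S T"
  unfolding commutator_subgroup_def by (auto intro!: generate.incl)

lemma commutator_subgroup_is_subgroup:
  "S \<subseteq> carrier G \<Longrightarrow> T \<subseteq> carrier G \<Longrightarrow> subgroup (commutator_subgroup G S T) G"
  unfolding commutator_subgroup_def by (intro generate_is_subgroup) (auto simp: subset_iff)

lemma commutator_subgroup_mono:
  assumes "S \<subseteq> S'" "T \<subseteq> T'"
  shows "commutator_subgroup G S T \<subseteq> commutator_subgroup G S' T'"
  unfolding commutator_subgroup_def using assms by (intro mono_generate) blast

text \<open>In g x g^-1 = [g, x] x the first factor lies in \<open>F\<close>, hence in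
  \<open>M\<close>.\<close>

lemma normal_if_central_mod:
  assumes F: "F \<lhd> G" and M: "subgroup M G" and "F \<subseteq> M" "M \<subseteq> cent F (carrier G)"
  shows "M \<lhd> G"
proof (rule normal_invI[OF M])
  fix g x assume g: "g \<in> carrier G" and x: "x \<in> M"
  then have xc: "x \<in> carrier G"
    using subgroup.subset[OF M] by blast
  have "commutator G x g \<in> F"
    using assms(4) g x by (auto simp: cent_def)
  then have "commutator G g x \<in> M"
    using commutator_sym_mem[OF normal_imp_subgroup[OF F] xc g] assms(3) by blast
  then have "conjg g x \<in> M"
    using M g x xc by (simp add: conjg_eq subgroup.m_closed)
  then show "g \<otimes> x \<otimes> inv g \<in> M"
    by (simp add: conjg_def)
qed

text \<open>The degenerate case of the Hall--Witt identity in which one of the three commutators is trivial.\<close>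
lemma hall_witt_degenerate:
  assumes c: "u \<in> carrier G" "v \<in> carrier G" "w \<in> carrier G"
    and uw: "u \<otimes> w = w \<otimes> u" and "commutator G v w \<otimes> v = v \<otimes> commutator G v w"
  shows "\<exists>g \<in> carrier G. commutator G (commutator G u v) w = conjg g (commutator G u (commutator G v w))"
proof -
  define s where "s = commutator G v w"
  have s: "s \<in> carrier G" "s \<otimes> v = v \<otimes> s"
    using assms by (simp_all add: s_def)
  have wu: "conjg w u = u"
    using c unfolding conjg_def uw[symmetric] by (simp add: m_assoc)
  have sv: "inv s \<otimes> v = v \<otimes> inv s"
  proof -
    have "inv s \<otimes> v = inv s \<otimes> (v \<otimes> s) \<otimes> inv s"
      using c s(1) by (simp add: m_assoc)
    also have "\<dots> = v \<otimes> inv s"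
      using c s(1) by (simp add: m_assoc inv_mult_cancel flip: s(2))
    finally show ?thesis .
  qed
  have "conjg w v = inv s \<otimes> v"
    using c by (simp add: s_def word_simps)
  then have wv: "conjg w v = v \<otimes> inv s"
    by (simp add: sv)
  \<comment> \<open>Since [x, w] = x (w x w^-1)^-1, it suffices to conjugate [u, v] by
    \<open>w\<close>, which fixes \<open>u\<close> and sends \<open>v\<close> to
    \<open>v \<otimes> inv s\<close>.\<close>
  have "commutator G (commutator G u v) w = commutator G u v \<otimes> inv (conjg w (commutator G u v))"
    using c by (simp add: word_simps)
  also have "\<dots> = commutator G u v \<otimes> inv (commutator G u (v \<otimes> inv s))"
    using c by (simp add: conjg_commutator wu wv)
  also have "\<dots> = conjg (commutator G u v \<otimes> v \<otimes> inv s) (commutator G u s)"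
    using c s by (simp add: word_simps)
  finally show ?thesis
    unfolding s_def[symmetric]
    using c s by (intro bexI[of _ "commutator G u v \<otimes> v \<otimes> inv s"]) auto
qed

section \<open>Passage to the quotient by a normal subgroup\<close>

lemma group_hom_Mod: "N \<lhd> G \<Longrightarrow> group_hom G (G Mod N) (\<lambda>x. N #> x)"
  by (intro group_hom.intro group_hom_axioms.intro is_group normal.factorgroup_is_group
      normal.r_coset_hom_Mod)

lemma rcos_eq_one_Mod_iff:
  assumes "N \<lhd> G" "x \<in> carrier G"
  shows "N #> x = \<one>\<^bsub>G Mod N\<^esub> \<longleftrightarrow> x \<in> N"
  using assms coset_join1[of N x] coset_join2[of x N] normal_imp_subgroup[of N G] subgroup.subset
  by (auto simp: FactGroup_def)

lemma rcos_commute_iff: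
  assumes "N \<lhd> G" "x \<in> carrier G" "y \<in> carrier G"
  shows "(N #> x) \<otimes>\<^bsub>G Mod N\<^esub> (N #> y) = (N #> y) \<otimes>\<^bsub>G Mod N\<^esub> (N #> x) \<longleftrightarrow> commutator G x y \<in> N"
proof -
  interpret h: group_hom G "G Mod N" "\<lambda>x. N #> x"
    using assms(1) by (rule group_hom_Mod)
  show ?thesis
    using assms by (simp add: h.hom_commutator h.hom_closed flip: rcos_eq_one_Mod_iff h.H.commutator_eq_one_iff)
qed

text \<open>In the quotient, conjugation by \<open>w\<close> fixes \<open>u\<close> and sends
  \<open>v\<close> to b v with b = [w, v]. So it sends [u, v] to [u, b v] = [u, b] (b [u, v] b^-1),
  which the hypotheses reduce to [u, v] again.\<close>

lemma commutator_commutator_mem_normal: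
  assumes N: "N \<lhd> G" and c: "u \<in> carrier G" "v \<in> carrier G" "w \<in> carrier G"
    and uw: "commutator G u w \<in> N" "commutator G u (commutator G w v) \<in> N"
      "commutator G (commutator G w v) (commutator G u v) \<in> N"
  shows "commutator G (commutator G u v) w \<in> N"
proof -
  interpret Q: group_hom G "G Mod N" "\<lambda>x. N #> x"
    using N by (rule group_hom_Mod)
  let ?u = "N #> u" and ?v = "N #> v" and ?w = "N #> w"
  define b where "b = commutator (G Mod N) ?w ?v"
  have Qc: "?u \<in> carrier (G Mod N)" "?v \<in> carrier (G Mod N)" "?w \<in> carrier (G Mod N)"
    using c by simp_all
  then have b: "b \<in> carrier (G Mod N)"
    by (simp add: b_def)
  have "commutator (G Mod N) ?u ?w = \<one>\<^bsub>G Mod N\<^esub>" "commutator (G Mod N) ?u b = \<one>\<^bsub>G Mod N\<^esub>"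
      "commutator (G Mod N) b (commutator (G Mod N) ?u ?v) = \<one>\<^bsub>G Mod N\<^esub>"
    using c uw by (simp_all add: b_def rcos_eq_one_Mod_iff[OF N] flip: Q.hom_commutator)
  then have 1: "?u \<otimes>\<^bsub>G Mod N\<^esub> ?w = ?w \<otimes>\<^bsub>G Mod N\<^esub> ?u" and ub: "commutator (G Mod N) ?u b = \<one>\<^bsub>G Mod N\<^esub>"
    and 2: "Q.H.conjg b (commutator (G Mod N) ?u ?v) = commutator (G Mod N) ?u ?v"
    using Qc b by (simp_all add: Q.H.commutator_eq_one_iff Q.H.conjg_eq)
  have wu: "Q.H.conjg ?w ?u = ?u"
    using Qc unfolding Q.H.conjg_def 1[symmetric] by (simp add: Q.H.m_assoc)
  have "Q.H.conjg ?w (commutator (G Mod N) ?u ?v) = commutator (G Mod N) ?u (b \<otimes>\<^bsub>G Mod N\<^esub> ?v)"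
    using Qc by (simp add: Q.H.conjg_commutator wu b_def Q.H.conjg_eq[of ?w ?v])
  also have "\<dots> = commutator (G Mod N) ?u b \<otimes>\<^bsub>G Mod N\<^esub> Q.H.conjg b (commutator (G Mod N) ?u ?v)"
    using Qc b by (simp add: Q.H.word_simps)
  also have "\<dots> = commutator (G Mod N) ?u ?v"
    using Qc by (simp add: ub 2)
  finally have "commutator (G Mod N) ?w (commutator (G Mod N) ?u ?v) = \<one>\<^bsub>G Mod N\<^esub>"
    using Qc by (simp add: Q.H.conjg_eq)
  then have "commutator G w (commutator G u v) \<in> N"
    using c by (simp add: rcos_eq_one_Mod_iff[OF N] flip: Q.hom_commutator)
  then show ?thesis
    using c by - (rule commutator_sym_mem[OF normal_imp_subgroup[OF N]], auto)
qed

lemma commutator_eqI: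
  "\<lbrakk>x \<in> carrier G; y \<in> carrier G; c \<in> carrier G; x \<otimes> y = c \<otimes> y \<otimes> x\<rbrakk> \<Longrightarrow> commutator G x y = c"
  by (simp add: commutator_def m_assoc)

section \<open>Commutators computed inside a subgroup\<close>

lemma commutator_consistent:
  "\<lbrakk>subgroup H G; x \<in> H; y \<in> H\<rbrakk> \<Longrightarrow> commutator (G\<lparr>carrier := H\<rparr>) x y = commutator G x y"
  by (simp add: commutator_def)

lemma commutator_subgroup_consistent:
  assumes H: "subgroup H G" and "S \<subseteq> H" "T \<subseteq> H"
  shows "commutator_subgroup (G\<lparr>carrier := H\<rparr>) S T = commutator_subgroup G S T"
    and "commutator_subgroup G S T \<subseteq> H"
proof -
  have eq: "{commutator (G\<lparr>carrier := H\<rparr>) f h | f h. f \<in> S \<and> h \<in> T} = {commutator G f h | f h. f \<in> S \<and> h \<in> T}"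
    using assms commutator_consistent[OF H] by (intro Collect_cong) (metis subsetD)
  have sub: "{commutator G f h | f h. f \<in> S \<and> h \<in> T} \<subseteq> H"
    using assms by (auto simp: commutator_def subset_iff intro!: subgroup.m_closed[OF H] subgroup.m_inv_closed[OF H])
  show "commutator_subgroup (G\<lparr>carrier := H\<rparr>) S T = commutator_subgroup G S T"
    unfolding commutator_subgroup_def eq using sub H by (rule generate_consistent)
  show "commutator_subgroup G S T \<subseteq> H"
    unfolding commutator_subgroup_def using sub H by (rule generate_subgroup_incl)
qed

end

section \<open>Symmetrised products of ideals\<close>

context ring
begin

lemma symm_prod_ideal: "\<lbrakk>ideal A R; ideal B R\<rbrakk> \<Longrightarrow> ideal (symm_prod R A B) R"
  unfolding symm_prod_def by (intro add_ideals ideal_prod_is_ideal)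

lemma ideal_prod_subset_symm_prod:
  assumes "ideal A R" "ideal B R"
  shows "ideal_prod R A B \<subseteq> symm_prod R A B" "ideal_prod R B A \<subseteq> symm_prod R A B"
proof -
  interpret AB: ideal "ideal_prod R A B" R
    using assms by (rule ideal_prod_is_ideal)
  interpret BA: ideal "ideal_prod R B A" R
    using assms(2,1) by (rule ideal_prod_is_ideal)
  have "x = x \<oplus> \<zero>" "x = \<zero> \<oplus> x" if "x \<in> ideal_prod R A B \<or> x \<in> ideal_prod R B A" for x
    using that AB.Icarr BA.Icarr by auto
  then show "ideal_prod R A B \<subseteq> symm_prod R A B" "ideal_prod R B A \<subseteq> symm_prod R A B"
    using AB.zero_closed BA.zero_closed unfolding symm_prod_def set_add_def' by blast+
qed

lemma mult_mem_symm_prod: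
  assumes "ideal A R" "ideal B R" "a \<in> A" "b \<in> B"
  shows "a \<otimes> b \<in> symm_prod R A B \<and> b \<otimes> a \<in> symm_prod R A B"
  using ideal_prod_subset_symm_prod[OF assms(1,2)] assms(3,4) by (blast intro: ideal_prod.prod)

text \<open>Elements of the symmetrised product are finite sums of products. \<open>M\<close> is an
  arbitrary additively closed set, so that it may be cut out by a condition on group
  elements.\<close>

lemma symm_prod_minimal:
  assumes M: "\<And>a b. \<lbrakk>a \<in> A; b \<in> B\<rbrakk> \<Longrightarrow> a \<otimes> b \<in> M \<and> b \<otimes> a \<in> M"
    and add: "\<And>a b. \<lbrakk>a \<in> M; b \<in> M\<rbrakk> \<Longrightarrow> a \<oplus> b \<in> M"
  shows "symm_prod R A B \<subseteq> M"
proof -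
  have "x \<in> M" if "x \<in> ideal_prod R A B" for x
    using that by induction (use M add in auto)
  moreover have "x \<in> M" if "x \<in> ideal_prod R B A" for x
    using that by induction (use M add in auto)
  ultimately show ?thesis
    unfolding symm_prod_def set_add_def' using add by blast
qed

end

section \<open>Groups with Steinberg relations\<close>

text \<open>The model is E(n, R) rather than GL(n, R): by \<open>generated\<close>, normality in
  \<open>G\<close> can be tested on conjugation by the elements \<open>t i j c\<close>.\<close>

locale steinberg = group G + R: ring R
  for G :: "('g, 'b) monoid_scheme" (structure) and R :: "('r, 'c) ring_scheme" (structure) +
  fixes Ix :: "'i set" and t :: "'i \<Rightarrow> 'i \<Rightarrow> 'r \<Rightarrow> 'g"
  assumes t_closed [simp]:
      "\<lbrakk>i \<in> Ix; j \<in> Ix; i \<noteq> j; a \<in> carrier R\<rbrakk> \<Longrightarrow> t i j a \<in> carrier G"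
    and t_add: "\<lbrakk>i \<in> Ix; j \<in> Ix; i \<noteq> j; a \<in> carrier R; b \<in> carrier R\<rbrakk>
      \<Longrightarrow> t i j (a \<oplus>\<^bsub>R\<^esub> b) = t i j a \<otimes> t i j b"
    and commutator_t: "\<lbrakk>i \<in> Ix; j \<in> Ix; k \<in> Ix; i \<noteq> j; i \<noteq> k; j \<noteq> k; a \<in> carrier R; b \<in> carrier R\<rbrakk>
      \<Longrightarrow> commutator G (t i j a) (t j k b) = t i k (a \<otimes>\<^bsub>R\<^esub> b)"
    and commutator_t_one: "\<lbrakk>i \<in> Ix; j \<in> Ix; k \<in> Ix; l \<in> Ix; i \<noteq> j; k \<noteq> l; i \<noteq> l; j \<noteq> k;
        a \<in> carrier R; b \<in> carrier R\<rbrakk> \<Longrightarrow> commutator G (t i j a) (t k l b) = \<one>"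
    and generated: "carrier G = generate G {t i j c | i j c. i \<in> Ix \<and> j \<in> Ix \<and> i \<noteq> j \<and> c \<in> carrier R}"
    and card_Ix: "card Ix \<ge> 4"
begin

section \<open>Choice of indices and first consequences of the Steinberg relations\<close>

lemma ex_index_notin:
  assumes "finite S" "card S < 4"
  obtains h where "h \<in> Ix" "h \<notin> S"
  using assms card_Ix card_mono[of S Ix] by (metis le_trans not_less subsetI)

lemma ex_third:
  obtains h where "h \<in> Ix" "h \<noteq> i" "h \<noteq> j"
proof (rule ex_index_notin[of "{i, j}"])
  show "card {i, j} < 4"
    by (rule order.strict_trans1[OF card_insert_le_m1]) auto
qed auto

text \<open>This is where the fourth index is used: a second pair of indices can avoid a given
  one.\<close>

lemma ex_disjoint_pair:
  obtains k l where "k \<in> Ix" "l \<in> Ix" "k \<noteq> l" "{k, l} \<inter> {i, j} = {}"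
proof -
  obtain k where k: "k \<in> Ix" "k \<noteq> i" "k \<noteq> j"
    using ex_third .
  have "card {i, j, k} < 4"
    by (simp add: card_insert_if)
  then obtain l where "l \<in> Ix" "l \<notin> {i, j, k}"
    by (rule ex_index_notin[rotated]) auto
  then show ?thesis
    using k by (intro that[of k l]) auto
qed

lemma t_zero: "\<lbrakk>i \<in> Ix; j \<in> Ix; i \<noteq> j\<rbrakk> \<Longrightarrow> t i j \<zero>\<^bsub>R\<^esub> = \<one>"
  using t_add[of i j "\<zero>\<^bsub>R\<^esub>" "\<zero>\<^bsub>R\<^esub>"] by simp

lemma t_inv: "\<lbrakk>i \<in> Ix; j \<in> Ix; i \<noteq> j; a \<in> carrier R\<rbrakk> \<Longrightarrow> inv (t i j a) = t i j (\<ominus>\<^bsub>R\<^esub> a)"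
  using t_add[of i j "\<ominus>\<^bsub>R\<^esub> a" a] by (intro inv_equality) (simp_all add: R.l_neg t_zero)

lemma conjg_t_one:
  "\<lbrakk>i \<in> Ix; j \<in> Ix; k \<in> Ix; l \<in> Ix; i \<noteq> j; k \<noteq> l; i \<noteq> l; j \<noteq> k; a \<in> carrier R; b \<in> carrier R\<rbrakk>
    \<Longrightarrow> conjg (t i j a) (t k l b) = t k l b"
  by (simp add: conjg_eq commutator_t_one)

lemma t_commute:
  "\<lbrakk>i \<in> Ix; j \<in> Ix; k \<in> Ix; l \<in> Ix; i \<noteq> j; k \<noteq> l; i \<noteq> l; j \<noteq> k; a \<in> carrier R; b \<in> carrier R\<rbrakk>
    \<Longrightarrow> t i j a \<otimes> t k l b = t k l b \<otimes> t i j a"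
  using commutator_eq_one_iff[of "t i j a" "t k l b"] by (simp add: commutator_t_one)

lemma conjg_t_left:
  assumes "i \<in> Ix" "j \<in> Ix" "k \<in> Ix" "i \<noteq> j" "i \<noteq> k" "j \<noteq> k" "a \<in> carrier R" "b \<in> carrier R"
  shows "conjg (t i j a) (t j k b) = t i k (a \<otimes>\<^bsub>R\<^esub> b) \<otimes> t j k b"
  using assms by (simp add: conjg_eq commutator_t)

lemma conjg_t_right:
  assumes "i \<in> Ix" "j \<in> Ix" "k \<in> Ix" "i \<noteq> j" "i \<noteq> k" "j \<noteq> k" "a \<in> carrier R" "b \<in> carrier R"
  shows "conjg (t j k b) (t i j a) = t i k (\<ominus>\<^bsub>R\<^esub> (a \<otimes>\<^bsub>R\<^esub> b)) \<otimes> t i j a"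
  using assms by (simp add: conjg_eq commutator_swap[of "t i j a"] commutator_t t_inv)

text \<open>In the matrix model, \<open>col i j h\<close> places the vector (p, q) in column
  \<open>h\<close> at rows \<open>i\<close> and \<open>j\<close>, and \<open>row i j h\<close>
  places it in row \<open>h\<close> at columns \<open>i\<close> and \<open>j\<close>. By
  \<open>col_mult\<close> and \<open>row_mult\<close> both are additive.\<close>

definition col :: "'i \<Rightarrow> 'i \<Rightarrow> 'i \<Rightarrow> 'r \<Rightarrow> 'r \<Rightarrow> 'g" where
  "col i j h p q = t i h p \<otimes> t j h q"

definition row :: "'i \<Rightarrow> 'i \<Rightarrow> 'i \<Rightarrow> 'r \<Rightarrow> 'r \<Rightarrow> 'g" where
  "row i j h p q = t h i p \<otimes> t h j q"

context
  fixes i j h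
  assumes ijh [simp]: "i \<in> Ix" "j \<in> Ix" "h \<in> Ix" "i \<noteq> j" "i \<noteq> h" "j \<noteq> h"
    "j \<noteq> i" "h \<noteq> i" "h \<noteq> j"
begin

lemma col_closed: "\<lbrakk>p \<in> carrier R; q \<in> carrier R\<rbrakk> \<Longrightarrow> col i j h p q \<in> carrier G"
  by (simp add: col_def)

lemma row_closed: "\<lbrakk>p \<in> carrier R; q \<in> carrier R\<rbrakk> \<Longrightarrow> row i j h p q \<in> carrier G"
  by (simp add: row_def)

lemma col_mult:
  assumes "p \<in> carrier R" "q \<in> carrier R" "p' \<in> carrier R" "q' \<in> carrier R"
  shows "col i j h p q \<otimes> col i j h p' q' = col i j h (p \<oplus>\<^bsub>R\<^esub> p') (q \<oplus>\<^bsub>R\<^esub> q')"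
proof -
  have "t j h q \<otimes> (t i h p' \<otimes> t j h q') = t i h p' \<otimes> (t j h q \<otimes> t j h q')"
    using assms by (simp add: t_commute[of j h i h] flip: m_assoc)
  then show ?thesis
    using assms by (simp add: col_def t_add m_assoc)
qed

lemma row_mult:
  assumes "p \<in> carrier R" "q \<in> carrier R" "p' \<in> carrier R" "q' \<in> carrier R"
  shows "row i j h p q \<otimes> row i j h p' q' = row i j h (p \<oplus>\<^bsub>R\<^esub> p') (q \<oplus>\<^bsub>R\<^esub> q')"
proof -
  have "t h j q \<otimes> (t h i p' \<otimes> t h j q') = t h i p' \<otimes> (t h j q \<otimes> t h j q')"
    using assms by (simp add: t_commute[of h j h i] flip: m_assoc)
  then show ?thesis
    using assms by (simp add: row_def t_add m_assoc)
qed

text \<open>Columns are multiplied from the left by a 2 by 2 elementary matrix.\<close>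

lemma conjg_col:
  assumes [simp]: "c \<in> carrier R" "p \<in> carrier R" "q \<in> carrier R"
  shows "conjg (t i j c) (col i j h p q) = col i j h (p \<oplus>\<^bsub>R\<^esub> c \<otimes>\<^bsub>R\<^esub> q) q"
    and "conjg (t j i c) (col i j h p q) = col i j h p (q \<oplus>\<^bsub>R\<^esub> c \<otimes>\<^bsub>R\<^esub> p)"
proof -
  show "conjg (t i j c) (col i j h p q) = col i j h (p \<oplus>\<^bsub>R\<^esub> c \<otimes>\<^bsub>R\<^esub> q) q"
    by (simp add: col_def conjg_mult conjg_t_one conjg_t_left t_add m_assoc)
  show "conjg (t j i c) (col i j h p q) = col i j h p (q \<oplus>\<^bsub>R\<^esub> c \<otimes>\<^bsub>R\<^esub> p)"
    by (simp add: col_def conjg_mult conjg_t_one conjg_t_left t_add R.a_comm[of q] m_assoc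
        t_commute[of j h i h] flip: m_assoc[of "t j h _" "t i h _" "t j h _"])
qed

text \<open>Rows are multiplied from the right by the inverse elementary matrix, hence the minus
  signs.\<close>

lemma conjg_row:
  assumes [simp]: "c \<in> carrier R" "p \<in> carrier R" "q \<in> carrier R"
  shows "conjg (t i j c) (row i j h p q) = row i j h p (q \<ominus>\<^bsub>R\<^esub> p \<otimes>\<^bsub>R\<^esub> c)"
    and "conjg (t j i c) (row i j h p q) = row i j h (p \<ominus>\<^bsub>R\<^esub> q \<otimes>\<^bsub>R\<^esub> c) q"
proof -
  show "conjg (t i j c) (row i j h p q) = row i j h p (q \<ominus>\<^bsub>R\<^esub> p \<otimes>\<^bsub>R\<^esub> c)"
    by (simp add: row_def conjg_mult conjg_t_one conjg_t_right t_add R.minus_eq R.a_comm[of q] m_assoc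
        t_commute[of h j h i] flip: m_assoc[of "t h j _" "t h i _" "t h j _"])
  show "conjg (t j i c) (row i j h p q) = row i j h (p \<ominus>\<^bsub>R\<^esub> q \<otimes>\<^bsub>R\<^esub> c) q"
    by (simp add: row_def conjg_mult conjg_t_one conjg_t_right t_add R.minus_eq m_assoc)
qed

text \<open>Both entries of the commutator have exactly one index in {i, j}, so facts about such
  transvections carry over to \<open>t i j a\<close>.\<close>

lemma t_eq_commutator:
  "a \<in> carrier R \<Longrightarrow> t i j a = commutator G (t i h a) (t h j \<one>\<^bsub>R\<^esub>)"
  by (simp add: commutator_t)

end

section \<open>Elementary subgroups, relative subgroups and elementary commutators\<close>

definition El :: "'r set \<Rightarrow> 'g set" where
  "El A = generate G {t i j a | i j a. i \<in> Ix \<and> j \<in> Ix \<and> i \<noteq> j \<and> a \<in> A}"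

definition z :: "'i \<Rightarrow> 'i \<Rightarrow> 'r \<Rightarrow> 'r \<Rightarrow> 'g" where
  "z i j c a = conjg (t j i c) (t i j a)"

text \<open>By \<open>rel_normal\<close> below, this is the normal closure of \<open>El A\<close>.\<close>
definition rel :: "'r set \<Rightarrow> 'g set" where
  "rel A = generate G {z i j c a | i j c a. i \<in> Ix \<and> j \<in> Ix \<and> i \<noteq> j \<and> c \<in> carrier R \<and> a \<in> A}"

definition y :: "'i \<Rightarrow> 'i \<Rightarrow> 'r \<Rightarrow> 'r \<Rightarrow> 'g" where
  "y i j a b = commutator G (t i j a) (t j i b)"

text \<open>In matrix terms, \<open>g\<close> acts on the vectors over \<open>i\<close>,
  \<open>j\<close> as the identity modulo \<open>A\<close>. The correction is the left summand, so
  that g v g^-1 = [g, v] v exhibits [g, v] as a column or row over \<open>A\<close>.\<close>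

definition acts_triv :: "'r set \<Rightarrow> 'i \<Rightarrow> 'i \<Rightarrow> 'g \<Rightarrow> bool" where
  "acts_triv A i j g \<longleftrightarrow> (\<forall>h\<in>Ix. h \<noteq> i \<longrightarrow> h \<noteq> j \<longrightarrow> (\<forall>p\<in>carrier R. \<forall>q\<in>carrier R.
     (\<exists>p'\<in>A. \<exists>q'\<in>A. conjg g (col i j h p q) = col i j h (p' \<oplus>\<^bsub>R\<^esub> p) (q' \<oplus>\<^bsub>R\<^esub> q)) \<and>
     (\<exists>p'\<in>A. \<exists>q'\<in>A. conjg g (row i j h p q) = row i j h (p' \<oplus>\<^bsub>R\<^esub> p) (q' \<oplus>\<^bsub>R\<^esub> q))))"

lemma y_closed [simp]:
  "\<lbrakk>i \<in> Ix; j \<in> Ix; i \<noteq> j; a \<in> carrier R; b \<in> carrier R\<rbrakk> \<Longrightarrow> y i j a b \<in> carrier G"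
  by (simp add: y_def)

lemma z_closed [simp]:
  "\<lbrakk>i \<in> Ix; j \<in> Ix; i \<noteq> j; a \<in> carrier R; c \<in> carrier R\<rbrakk> \<Longrightarrow> z i j c a \<in> carrier G"
  by (simp add: z_def)

lemma t_in_El: "\<lbrakk>i \<in> Ix; j \<in> Ix; i \<noteq> j; a \<in> A\<rbrakk> \<Longrightarrow> t i j a \<in> El A"
  unfolding El_def by (rule generate.incl) blast

lemma z_in_rel: "\<lbrakk>i \<in> Ix; j \<in> Ix; i \<noteq> j; c \<in> carrier R; a \<in> A\<rbrakk> \<Longrightarrow> z i j c a \<in> rel A"
  unfolding rel_def by (rule generate.incl) blast

lemma t_generators_subset:
  "A \<subseteq> carrier R \<Longrightarrow> {t i j a | i j a. i \<in> Ix \<and> j \<in> Ix \<and> i \<noteq> j \<and> a \<in> A} \<subseteq> carrier G"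
  by auto

lemma z_generators_subset:
  "A \<subseteq> carrier R \<Longrightarrow> {z i j c a | i j c a. i \<in> Ix \<and> j \<in> Ix \<and> i \<noteq> j \<and> c \<in> carrier R \<and> a \<in> A} \<subseteq> carrier G"
  by auto

section \<open>Subgroups attached to a single ideal, and normality of \<open>rel A\<close>\<close>

context
  fixes A
  assumes A: "ideal A R"
begin

interpretation A: ideal A R by (rule A)

lemma ideal_subset: "A \<subseteq> carrier R"
  by (rule A.a_subset)

lemma El_subgroup: "subgroup (El A) G"
  unfolding El_def by (intro generate_is_subgroup t_generators_subset ideal_subset)

lemma rel_subgroup: "subgroup (rel A) G"
  unfolding rel_def by (intro generate_is_subgroup z_generators_subset ideal_subset)

lemma El_subset: "El A \<subseteq> carrier G"
  using El_subgroup subgroup.subset by blast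

lemma rel_subset: "rel A \<subseteq> carrier G"
  using rel_subgroup subgroup.subset by blast

lemma El_minimal:
  assumes "subgroup M G" "\<And>i j a. \<lbrakk>i \<in> Ix; j \<in> Ix; i \<noteq> j; a \<in> A\<rbrakk> \<Longrightarrow> t i j a \<in> M"
  shows "El A \<subseteq> M"
  unfolding El_def using assms by (intro generate_subgroup_incl) auto

lemma rel_minimal:
  assumes "subgroup M G"
    and "\<And>i j c a. \<lbrakk>i \<in> Ix; j \<in> Ix; i \<noteq> j; c \<in> carrier R; a \<in> A\<rbrakk> \<Longrightarrow> z i j c a \<in> M"
  shows "rel A \<subseteq> M"
  unfolding rel_def using assms by (intro generate_subgroup_incl) auto

text \<open>A normal target absorbs the conjugation in the generators \<open>z i j c a\<close>,
  leaving only transvections to check.\<close>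

lemma rel_minimal_normal:
  assumes M: "M \<lhd> G" and "\<And>i j a. \<lbrakk>i \<in> Ix; j \<in> Ix; i \<noteq> j; a \<in> A\<rbrakk> \<Longrightarrow> t i j a \<in> M"
  shows "rel A \<subseteq> M"
proof (rule rel_minimal)
  show "subgroup M G"
    using M by (rule normal_imp_subgroup)
qed (use assms in \<open>auto simp: z_def intro!: conjg_mem_normal\<close>)

lemma t_in_rel: "\<lbrakk>i \<in> Ix; j \<in> Ix; i \<noteq> j; a \<in> A\<rbrakk> \<Longrightarrow> t i j a \<in> rel A"
  using z_in_rel[of i j "\<zero>\<^bsub>R\<^esub>" a A] by (simp add: z_def t_zero)

lemma El_subset_rel: "El A \<subseteq> rel A"
  by (intro El_minimal rel_subgroup t_in_rel)

lemma col_in_El: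
  "\<lbrakk>i \<in> Ix; j \<in> Ix; h \<in> Ix; i \<noteq> h; j \<noteq> h; p \<in> A; q \<in> A\<rbrakk> \<Longrightarrow> col i j h p q \<in> El A"
  unfolding col_def by (intro subgroup.m_closed[OF El_subgroup] t_in_El)

lemma row_in_El:
  "\<lbrakk>i \<in> Ix; j \<in> Ix; h \<in> Ix; i \<noteq> h; j \<noteq> h; p \<in> A; q \<in> A\<rbrakk> \<Longrightarrow> row i j h p q \<in> El A"
  unfolding row_def by (intro subgroup.m_closed[OF El_subgroup] t_in_El) auto

text \<open>The condition on \<open>k\<close>, \<open>l\<close> says that exactly one of them lies
  in {i, j}. Then \<open>t k l d\<close> is a column or row v with one zero entry, and [g, v] is the
  shift of v caused by \<open>g\<close>, with entries in \<open>A\<close>.\<close>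

lemma acts_triv_commutator:
  assumes g: "acts_triv A i j g" "g \<in> carrier G"
    and ij: "i \<in> Ix" "j \<in> Ix" "i \<noteq> j" and kl: "k \<in> Ix" "l \<in> Ix" "k \<in> {i, j} \<longleftrightarrow> l \<notin> {i, j}"
    and d: "d \<in> carrier R"
  shows "commutator G g (t k l d) \<in> El A"
proof -
  have col: "commutator G g (col i j h p q) \<in> El A"
    if h: "h \<in> Ix" "h \<noteq> i" "h \<noteq> j" and pq: "p \<in> carrier R" "q \<in> carrier R" for h p q
  proof -
    obtain p' q' where p': "p' \<in> A" "q' \<in> A"
      and "conjg g (col i j h p q) = col i j h (p' \<oplus>\<^bsub>R\<^esub> p) (q' \<oplus>\<^bsub>R\<^esub> q)"
      using g(1) h pq unfolding acts_triv_def by blast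
    then have "commutator G g (col i j h p q) \<otimes> col i j h p q = col i j h p' q' \<otimes> col i j h p q"
      using ij h pq g(2) col_mult[of i j h p' q' p q] by (simp add: col_closed A.Icarr flip: conjg_eq)
    then have "commutator G g (col i j h p q) = col i j h p' q'"
      using ij h pq g(2) p' by (simp add: col_closed A.Icarr)
    then show ?thesis
      using p' ij h by (simp add: col_in_El)
  qed
  have row: "commutator G g (row i j h p q) \<in> El A"
    if h: "h \<in> Ix" "h \<noteq> i" "h \<noteq> j" and pq: "p \<in> carrier R" "q \<in> carrier R" for h p q
  proof -
    obtain p' q' where p': "p' \<in> A" "q' \<in> A"
      and "conjg g (row i j h p q) = row i j h (p' \<oplus>\<^bsub>R\<^esub> p) (q' \<oplus>\<^bsub>R\<^esub> q)"
      using g(1) h pq unfolding acts_triv_def by blast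
    then have "commutator G g (row i j h p q) \<otimes> row i j h p q = row i j h p' q' \<otimes> row i j h p q"
      using ij h pq g(2) row_mult[of i j h p' q' p q] by (simp add: row_closed A.Icarr flip: conjg_eq)
    then have "commutator G g (row i j h p q) = row i j h p' q'"
      using ij h pq g(2) p' by (simp add: row_closed A.Icarr)
    then show ?thesis
      using p' ij h by (simp add: row_in_El)
  qed
  from kl consider "k = i" "l \<notin> {i, j}" | "k = j" "l \<notin> {i, j}" | "l = i" "k \<notin> {i, j}" | "l = j" "k \<notin> {i, j}"
    by blast
  then show ?thesis
  proof cases
    case 1
    then show ?thesis using col[of l d "\<zero>\<^bsub>R\<^esub>"] kl ij d by (auto simp: col_def t_zero)
  next
    case 2
    then show ?thesis using col[of l "\<zero>\<^bsub>R\<^esub>" d] kl ij d by (auto simp: col_def t_zero)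
  next
    case 3
    then show ?thesis using row[of k d "\<zero>\<^bsub>R\<^esub>"] kl ij d by (auto simp: row_def t_zero)
  next
    case 4
    then show ?thesis using row[of k "\<zero>\<^bsub>R\<^esub>" d] kl ij d by (auto simp: row_def t_zero)
  qed
qed

text \<open>The 2 by 2 matrix of \<open>z i j c a\<close> is conjugate to an elementary matrix with
  off-diagonal entry \<open>a\<close>, hence is the identity modulo \<open>A\<close>.\<close>

lemma acts_triv_z:
  assumes ij: "i \<in> Ix" "j \<in> Ix" "i \<noteq> j" and c: "c \<in> carrier R" and a: "a \<in> A"
  shows "acts_triv A i j (z i j c a)"
  unfolding acts_triv_def
proof (intro ballI impI conjI)
  fix h p q assume h: "h \<in> Ix" "h \<noteq> i" "h \<noteq> j" and pq: "p \<in> carrier R" "q \<in> carrier R"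
  have ac: "a \<in> carrier R"
    using a by (rule A.Icarr)
  have z: "conjg (z i j c a) x = conjg (t j i c) (conjg (t i j a) (conjg (t j i (\<ominus>\<^bsub>R\<^esub> c)) x))"
    if "x \<in> carrier G" for x
    using that ij c ac by (simp add: z_def conjg_conjg t_inv[symmetric]) (simp add: conjg_def m_assoc)
  \<comment> \<open>The second column entry after the innermost factor, \<open>t j i\<close> with
    parameter -c, has acted.\<close>
  define q' where "q' = q \<ominus>\<^bsub>R\<^esub> c \<otimes>\<^bsub>R\<^esub> p"
  have q': "q' \<in> carrier R"
    using pq c by (simp add: q'_def)
  have "conjg (z i j c a) (col i j h p q)
      = col i j h (p \<oplus>\<^bsub>R\<^esub> a \<otimes>\<^bsub>R\<^esub> q') (q' \<oplus>\<^bsub>R\<^esub> c \<otimes>\<^bsub>R\<^esub> (p \<oplus>\<^bsub>R\<^esub> a \<otimes>\<^bsub>R\<^esub> q'))"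
    using ij h pq c ac q' by (simp add: z col_closed conjg_col R.l_minus flip: R.minus_eq q'_def)
  also have "p \<oplus>\<^bsub>R\<^esub> a \<otimes>\<^bsub>R\<^esub> q' = a \<otimes>\<^bsub>R\<^esub> q' \<oplus>\<^bsub>R\<^esub> p"
    using pq ac q' by (simp add: R.a_comm)
  also have "q' \<oplus>\<^bsub>R\<^esub> c \<otimes>\<^bsub>R\<^esub> (a \<otimes>\<^bsub>R\<^esub> q' \<oplus>\<^bsub>R\<^esub> p) = c \<otimes>\<^bsub>R\<^esub> (a \<otimes>\<^bsub>R\<^esub> q') \<oplus>\<^bsub>R\<^esub> q"
    unfolding q'_def using pq ac c by algebra
  finally show "\<exists>x\<in>A. \<exists>y\<in>A. conjg (z i j c a) (col i j h p q) = col i j h (x \<oplus>\<^bsub>R\<^esub> p) (y \<oplus>\<^bsub>R\<^esub> q)"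
    using a c q' by (blast intro: A.I_l_closed A.I_r_closed)
  \<comment> \<open>The first row entry after the same innermost factor.\<close>
  define p' where "p' = p \<oplus>\<^bsub>R\<^esub> q \<otimes>\<^bsub>R\<^esub> c"
  have p': "p' \<in> carrier R"
    using pq c by (simp add: p'_def)
  have "p \<ominus>\<^bsub>R\<^esub> q \<otimes>\<^bsub>R\<^esub> (\<ominus>\<^bsub>R\<^esub> c) = p'"
    unfolding p'_def using pq c by algebra
  then have "conjg (z i j c a) (row i j h p q)
      = row i j h (p' \<ominus>\<^bsub>R\<^esub> (q \<ominus>\<^bsub>R\<^esub> p' \<otimes>\<^bsub>R\<^esub> a) \<otimes>\<^bsub>R\<^esub> c) (q \<ominus>\<^bsub>R\<^esub> p' \<otimes>\<^bsub>R\<^esub> a)"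
    using ij h pq c ac p' by (simp add: z row_closed conjg_row)
  also have "p' \<ominus>\<^bsub>R\<^esub> (q \<ominus>\<^bsub>R\<^esub> p' \<otimes>\<^bsub>R\<^esub> a) \<otimes>\<^bsub>R\<^esub> c = p' \<otimes>\<^bsub>R\<^esub> a \<otimes>\<^bsub>R\<^esub> c \<oplus>\<^bsub>R\<^esub> p"
    unfolding p'_def using pq ac c by algebra
  also have "q \<ominus>\<^bsub>R\<^esub> p' \<otimes>\<^bsub>R\<^esub> a = \<ominus>\<^bsub>R\<^esub> (p' \<otimes>\<^bsub>R\<^esub> a) \<oplus>\<^bsub>R\<^esub> q"
    using pq ac p' by algebra
  finally show "\<exists>x\<in>A. \<exists>y\<in>A. conjg (z i j c a) (row i j h p q) = row i j h (x \<oplus>\<^bsub>R\<^esub> p) (y \<oplus>\<^bsub>R\<^esub> q)"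
    using a c p' by (blast intro: A.I_l_closed A.I_r_closed A.a_inv_closed)
qed

text \<open>Conjugation by \<open>t h j s\<close> only adds a factor \<open>t i j x\<close> with x
  in \<open>A\<close>; \<open>t h i r\<close>, being opposite to \<open>t i h p\<close>, turns the
  latter into the generator \<open>z i h r p\<close>.\<close>

lemma conjg_row_t:
  assumes ijh: "i \<in> Ix" "j \<in> Ix" "h \<in> Ix" "i \<noteq> j" "i \<noteq> h" "j \<noteq> h"
    and rs: "r \<in> carrier R" "s \<in> carrier R" and p: "p \<in> A"
  shows "conjg (row i j h r s) (t i h p) \<in> rel A"
proof -
  have [simp]: "p \<in> carrier R"
    using p by (rule A.Icarr)
  define x where "x = \<ominus>\<^bsub>R\<^esub> (p \<otimes>\<^bsub>R\<^esub> s)"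
  have x: "x \<in> A" "x \<in> carrier R"
    using p rs by (simp_all add: x_def A.I_r_closed A.a_inv_closed)
  have "conjg (row i j h r s) (t i h p) = conjg (t h i r) (conjg (t h j s) (t i h p))"
    using ijh rs by (simp add: row_def conjg_conjg)
  also have "\<dots> = t h j (r \<otimes>\<^bsub>R\<^esub> x) \<otimes> t i j x \<otimes> z i h r p"
    using ijh rs x(2) by (simp add: conjg_t_right conjg_t_left conjg_mult z_def flip: x_def)
  also have "\<dots> \<in> rel A"
    using ijh rs x p by (intro subgroup.m_closed[OF rel_subgroup] t_in_rel z_in_rel A.I_l_closed) auto
  finally show ?thesis .
qed

lemma conjg_row_col:
  assumes ijh: "i \<in> Ix" "j \<in> Ix" "h \<in> Ix" "i \<noteq> j" "i \<noteq> h" "j \<noteq> h"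
    and rs: "r \<in> carrier R" "s \<in> carrier R" and p: "p \<in> A" "q \<in> A"
  shows "conjg (row i j h r s) (col i j h p q) \<in> rel A"
proof -
  \<comment> \<open>The two factors of a row commute, so \<open>i\<close> and \<open>j\<close> may
    be exchanged and \<open>conjg_row_t\<close> also covers the second column entry.\<close>
  have "row i j h r s = row j i h s r"
    unfolding row_def using ijh rs by (intro t_commute) auto
  then have "conjg (row i j h r s) (t j h q) \<in> rel A"
    using conjg_row_t[of j i h s r q] ijh rs p by simp
  then show ?thesis
    using conjg_row_t[OF ijh rs p(1)] ijh rs p
    by (simp add: col_def conjg_mult row_closed A.Icarr subgroup.m_closed[OF rel_subgroup])
qed

text \<open>Write \<open>t i j a = [t i h a, t h j 1]\<close> and conjugate both factors: \<open>t i j d \<otimes> t j i c\<close> acts linearly on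
  the columns \<open>col i j h\<close> and on the rows \<open>row i j h\<close>.\<close>
lemma conjg_t_z:
  assumes ij: "i \<in> Ix" "j \<in> Ix" "i \<noteq> j" and c: "c \<in> carrier R" "d \<in> carrier R" and a: "a \<in> A"
  shows "conjg (t i j d) (z i j c a) \<in> rel A"
proof -
  obtain h where h: "h \<in> Ix" "h \<noteq> i" "h \<noteq> j"
    by (rule ex_third)
  have ac [simp]: "a \<in> carrier R"
    using a by (rule A.Icarr)
  define g where "g = t i j d \<otimes> t j i c"
  have g: "g \<in> carrier G"
    using ij c by (simp add: g_def)
  \<comment> \<open>(p, q) and (r, s) are the images under \<open>g\<close> of the column (a, 0) and
    the row (0, 1), which are the two entries of the commutator for \<open>t i j a\<close>.\<close>
  define p q r s where "p = a \<oplus>\<^bsub>R\<^esub> d \<otimes>\<^bsub>R\<^esub> (c \<otimes>\<^bsub>R\<^esub> a)" and "q = c \<otimes>\<^bsub>R\<^esub> a"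
    and "r = \<ominus>\<^bsub>R\<^esub> c" and "s = \<one>\<^bsub>R\<^esub> \<ominus>\<^bsub>R\<^esub> (\<ominus>\<^bsub>R\<^esub> c) \<otimes>\<^bsub>R\<^esub> d"
  have pq: "p \<in> A" "q \<in> A" and rs: "r \<in> carrier R" "s \<in> carrier R"
    using c a by (simp_all add: p_def q_def r_def s_def A.I_l_closed A.a_closed)
  have "conjg g (col i j h a \<zero>\<^bsub>R\<^esub>) = col i j h p q"
    using ij h c by (simp add: g_def p_def q_def conjg_col col_closed flip: conjg_conjg)
  moreover have "conjg g (row i j h \<zero>\<^bsub>R\<^esub> \<one>\<^bsub>R\<^esub>) = row i j h r s"
    using ij h c by (simp add: g_def r_def s_def conjg_row row_closed R.minus_eq flip: conjg_conjg)
  ultimately have "conjg g (t i j a) = commutator G (col i j h p q) (row i j h r s)"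
    using ij h g by (subst t_eq_commutator[of i j h]) (simp_all add: conjg_commutator col_def row_def t_zero)
  \<comment> \<open>By [x, y] = x (y x y^-1)^-1 only the conjugate of the column by the row has to
    be controlled.\<close>
  also have "\<dots> = col i j h p q \<otimes> inv (conjg (row i j h r s) (col i j h p q))"
    using ij h pq rs by (simp add: word_simps col_closed row_closed A.Icarr)
  also have "\<dots> \<in> rel A"
    using ij h pq rs El_subset_rel
    by (auto intro!: subgroup.m_closed[OF rel_subgroup] subgroup.m_inv_closed[OF rel_subgroup]
        conjg_row_col col_in_El)
  finally show ?thesis
    using ij c by (simp add: g_def z_def conjg_conjg)
qed

text \<open>For equal pairs this is \<open>conjg_t_z\<close>; for opposite pairs the conjugating
  parameters add up; disjoint pairs act trivially; with one common index the commutator falls into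
  \<open>El A\<close>.\<close>

lemma conjg_t_z_in_rel:
  assumes ij: "i \<in> Ix" "j \<in> Ix" "i \<noteq> j" and kl: "k \<in> Ix" "l \<in> Ix" "k \<noteq> l"
    and c: "c \<in> carrier R" "d \<in> carrier R" and a: "a \<in> A"
  shows "conjg (t k l d) (z i j c a) \<in> rel A"
proof -
  have ac [simp]: "a \<in> carrier R"
    using a by (rule A.Icarr)
  consider "k = i" "l = j" | "k = j" "l = i" | "{k, l} \<inter> {i, j} = {}" | "k \<in> {i, j} \<longleftrightarrow> l \<notin> {i, j}"
    using kl by blast
  then show ?thesis
  proof cases
    case 1
    then show ?thesis using conjg_t_z[OF ij c a] by simp
  next
    case 2
    then have "conjg (t k l d) (z i j c a) = z i j (d \<oplus>\<^bsub>R\<^esub> c) a"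
      using ij c by (simp add: z_def conjg_conjg t_add)
    then show ?thesis using z_in_rel ij c a by simp
  next
    case 3
    then have disj: "k \<noteq> i" "k \<noteq> j" "l \<noteq> i" "l \<noteq> j" "i \<noteq> k" "j \<noteq> k" "i \<noteq> l" "j \<noteq> l"
      by auto
    have "conjg (t k l d) (z i j c a) = conjg (conjg (t k l d) (t j i c)) (conjg (t k l d) (t i j a))"
      unfolding z_def using ij kl c by (simp add: word_simps)
    also have "\<dots> = z i j c a"
      using ij kl c disj by (simp add: conjg_t_one z_def)
    finally show ?thesis
      using z_in_rel ij c(1) a by simp
  next
    case 4
    have "commutator G (z i j c a) (t k l d) \<in> rel A"
      using acts_triv_commutator[OF acts_triv_z[OF ij c(1) a] _ ij kl(1,2) 4 c(2)] ij c El_subset_rel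
      by auto
    then have "commutator G (t k l d) (z i j c a) \<in> rel A"
      using ij kl c by - (rule commutator_sym_mem[OF rel_subgroup], auto)
    then show ?thesis
      using ij kl c a by (simp add: conjg_eq subgroup.m_closed[OF rel_subgroup] z_in_rel)
  qed
qed

text \<open>Conjugation by a transvection maps generators, and by induction all of
  \<open>rel A\<close>, into \<open>rel A\<close>. A second induction follows a word in
  transvections for the conjugating element.\<close>

lemma rel_normal: "rel A \<lhd> G"
proof (rule normal_invI[OF rel_subgroup])
  have step: "conjg (t k l d) x \<in> rel A"
    if kl: "k \<in> Ix" "l \<in> Ix" "k \<noteq> l" "d \<in> carrier R" and "x \<in> rel A" for k l d x
    using \<open>x \<in> rel A\<close> unfolding rel_def
  proof (induction rule: generate.induct)
    case one
    then show ?case using kl generate.one by simp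
  next
    case (incl x)
    then show ?case using conjg_t_z_in_rel kl by (auto simp flip: rel_def)
  next
    case (inv x)
    then have "conjg (t k l d) x \<in> rel A" "x \<in> carrier G"
      using conjg_t_z_in_rel kl ideal_subset by auto
    then show ?case
      using kl subgroup.m_inv_closed[OF rel_subgroup] by (simp add: conjg_inv flip: rel_def)
  next
    case (eng x y)
    then show ?case
      using kl subgroup.m_closed[OF rel_subgroup] subsetD[OF rel_subset]
      by (simp add: conjg_mult flip: rel_def)
  qed
  fix g x assume g: "g \<in> carrier G" and "x \<in> rel A"
  have "\<forall>x\<in>rel A. conjg g x \<in> rel A"
    using g[unfolded generated]
  proof (induction rule: generate.induct)
    case one
    then show ?case using rel_subset by auto
  next
    case (incl g)
    then show ?case using step by blast
  next
    case (inv g)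
    then obtain k l d where "k \<in> Ix" "l \<in> Ix" "k \<noteq> l" "d \<in> carrier R" "g = t k l d"
      by blast
    then show ?case using step by (simp add: t_inv)
  next
    case (eng g g')
    then have "g \<in> carrier G" "g' \<in> carrier G"
      using generated by auto
    then show ?case
      using eng subsetD[OF rel_subset] by (simp flip: conjg_conjg)
  qed
  then show "g \<otimes> x \<otimes> inv g \<in> rel A"
    using \<open>x \<in> rel A\<close> by (simp add: conjg_def)
qed

end

section \<open>Elementary commutators modulo a relative subgroup\<close>

lemma y_swap:
  "\<lbrakk>i \<in> Ix; j \<in> Ix; i \<noteq> j; a \<in> carrier R; b \<in> carrier R\<rbrakk> \<Longrightarrow> y j i b a = inv (y i j a b)"
  unfolding y_def by (rule commutator_swap) auto

lemma conjg_t_y_disjoint: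
  assumes "i \<in> Ix" "j \<in> Ix" "i \<noteq> j" "k \<in> Ix" "l \<in> Ix" "k \<noteq> l" "{k, l} \<inter> {i, j} = {}"
    and "a \<in> carrier R" "b \<in> carrier R" "d \<in> carrier R"
  shows "conjg (t k l d) (y i j a b) = y i j a b"
proof -
  have "k \<noteq> i" "k \<noteq> j" "l \<noteq> i" "l \<noteq> j" "i \<noteq> k" "j \<noteq> k" "i \<noteq> l" "j \<noteq> l"
    using assms by auto
  then show ?thesis
    using assms by (simp add: y_def conjg_commutator conjg_t_one)
qed

text \<open>All four factors of \<open>y k l c d\<close> fix \<open>y i j a b\<close> under
  conjugation.\<close>

lemma commutator_y_disjoint:
  assumes ij: "i \<in> Ix" "j \<in> Ix" "i \<noteq> j" and kl: "k \<in> Ix" "l \<in> Ix" "k \<noteq> l"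
    and disj: "{k, l} \<inter> {i, j} = {}"
    and abcd: "a \<in> carrier R" "b \<in> carrier R" "c \<in> carrier R" "d \<in> carrier R"
  shows "commutator G (y k l c d) (y i j a b) = \<one>"
proof -
  have "conjg (t k l x) (y i j a b) = y i j a b" "conjg (t l k x) (y i j a b) = y i j a b"
    if "x \<in> carrier R" for x
    using that ij kl disj abcd by (auto intro!: conjg_t_y_disjoint)
  moreover have "conjg (y k l c d) u
      = conjg (t k l c) (conjg (t l k d) (conjg (t k l (\<ominus>\<^bsub>R\<^esub> c)) (conjg (t l k (\<ominus>\<^bsub>R\<^esub> d)) u)))"
    if "u \<in> carrier G" for u
    using that kl abcd by (simp add: y_def commutator_def conjg_conjg m_assoc flip: t_inv)
  ultimately have "conjg (y k l c d) (y i j a b) = y i j a b"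
    using ij abcd by simp
  then show ?thesis
    using ij kl abcd by (simp add: commutator_def conjg_def)
qed

text \<open>\<open>I\<close> plays the role of the symmetrised product of \<open>A\<close> and \<open>B\<close>.\<close>
context
  fixes A B I
  assumes A: "ideal A R" and B: "ideal B R" and I: "ideal I R"
    and AB: "\<And>a b. \<lbrakk>a \<in> A; b \<in> B\<rbrakk> \<Longrightarrow> a \<otimes>\<^bsub>R\<^esub> b \<in> I \<and> b \<otimes>\<^bsub>R\<^esub> a \<in> I"
begin

interpretation A: ideal A R by (rule A)
interpretation B: ideal B R by (rule B)
interpretation I: ideal I R by (rule I)

text \<open>An upper and a lower 2 by 2 elementary matrix with entries \<open>a\<close> and
  \<open>b\<close> commute modulo any ideal containing ab and ba.\<close>

lemma acts_triv_y:
  assumes ij: "i \<in> Ix" "j \<in> Ix" "i \<noteq> j" and ab: "a \<in> A" "b \<in> B"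
  shows "acts_triv I i j (y i j a b)"
  unfolding acts_triv_def
proof (intro ballI impI conjI)
  fix h p q assume h: "h \<in> Ix" "h \<noteq> i" "h \<noteq> j" and pq: "p \<in> carrier R" "q \<in> carrier R"
  have abc: "a \<in> carrier R" "b \<in> carrier R"
    using ab A.Icarr B.Icarr by auto
  have y: "conjg (y i j a b) x
      = conjg (t i j a) (conjg (t j i b) (conjg (t i j (\<ominus>\<^bsub>R\<^esub> a)) (conjg (t j i (\<ominus>\<^bsub>R\<^esub> b)) x)))"
    if "x \<in> carrier G" for x
    using that ij abc by (simp add: y_def commutator_def conjg_conjg m_assoc flip: t_inv)
  \<comment> \<open>The column entries while the four factors of the commutator act, rightmost
    first; each factor alters one entry.\<close>
  define q1 p1 q2 where "q1 = q \<ominus>\<^bsub>R\<^esub> b \<otimes>\<^bsub>R\<^esub> p" and "p1 = p \<ominus>\<^bsub>R\<^esub> a \<otimes>\<^bsub>R\<^esub> q1" and "q2 = q1 \<oplus>\<^bsub>R\<^esub> b \<otimes>\<^bsub>R\<^esub> p1"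
  have q1: "q1 \<in> carrier R" and p1: "p1 \<in> carrier R" and q2: "q2 \<in> carrier R"
    using pq abc by (simp_all add: q1_def p1_def q2_def)
  have "conjg (y i j a b) (col i j h p q) = col i j h (p1 \<oplus>\<^bsub>R\<^esub> a \<otimes>\<^bsub>R\<^esub> q2) q2"
    using ij h pq abc q1 p1 q2
    by (simp add: y col_closed conjg_col R.l_minus flip: R.minus_eq q1_def p1_def q2_def)
  also have "p1 \<oplus>\<^bsub>R\<^esub> a \<otimes>\<^bsub>R\<^esub> q2 = a \<otimes>\<^bsub>R\<^esub> b \<otimes>\<^bsub>R\<^esub> p1 \<oplus>\<^bsub>R\<^esub> p"
    unfolding q2_def using pq abc q1 by (simp add: p1_def) algebra
  also have "q2 = \<ominus>\<^bsub>R\<^esub> (b \<otimes>\<^bsub>R\<^esub> a \<otimes>\<^bsub>R\<^esub> q1) \<oplus>\<^bsub>R\<^esub> q"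
    \<comment> \<open>Only the leading \<open>q1\<close> is expanded; the other occurrences make up
      the correction term and stay symbolic.\<close>
    unfolding q2_def p1_def using pq abc q1 by (subst (1) q1_def) algebra
  finally show "\<exists>x\<in>I. \<exists>z\<in>I. conjg (y i j a b) (col i j h p q) = col i j h (x \<oplus>\<^bsub>R\<^esub> p) (z \<oplus>\<^bsub>R\<^esub> q)"
    using AB[OF ab] p1 q1 by (blast intro: I.I_l_closed I.I_r_closed I.a_inv_closed)
  \<comment> \<open>The corresponding intermediate row entries.\<close>
  define r1 s1 r2 where "r1 = p \<oplus>\<^bsub>R\<^esub> q \<otimes>\<^bsub>R\<^esub> b" and "s1 = q \<oplus>\<^bsub>R\<^esub> r1 \<otimes>\<^bsub>R\<^esub> a" and "r2 = r1 \<ominus>\<^bsub>R\<^esub> s1 \<otimes>\<^bsub>R\<^esub> b"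
  have r1: "r1 \<in> carrier R" and s1: "s1 \<in> carrier R" and r2: "r2 \<in> carrier R"
    using pq abc by (simp_all add: r1_def s1_def r2_def)
  have "p \<ominus>\<^bsub>R\<^esub> q \<otimes>\<^bsub>R\<^esub> (\<ominus>\<^bsub>R\<^esub> b) = r1" "q \<ominus>\<^bsub>R\<^esub> r1 \<otimes>\<^bsub>R\<^esub> (\<ominus>\<^bsub>R\<^esub> a) = s1"
    using pq abc r1 by (simp_all add: r1_def s1_def R.minus_eq R.r_minus)
  then have "conjg (y i j a b) (row i j h p q) = row i j h r2 (s1 \<ominus>\<^bsub>R\<^esub> r2 \<otimes>\<^bsub>R\<^esub> a)"
    using ij h pq abc r1 s1 r2 by (simp add: y row_closed conjg_row flip: r2_def)
  also have "s1 \<ominus>\<^bsub>R\<^esub> r2 \<otimes>\<^bsub>R\<^esub> a = s1 \<otimes>\<^bsub>R\<^esub> (b \<otimes>\<^bsub>R\<^esub> a) \<oplus>\<^bsub>R\<^esub> q"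
    unfolding r2_def using pq abc r1 by (simp add: s1_def) algebra
  also have "r2 = \<ominus>\<^bsub>R\<^esub> (r1 \<otimes>\<^bsub>R\<^esub> (a \<otimes>\<^bsub>R\<^esub> b)) \<oplus>\<^bsub>R\<^esub> p"
    unfolding r2_def s1_def using pq abc r1 by (subst (1) r1_def) algebra
  finally show "\<exists>x\<in>I. \<exists>z\<in>I. conjg (y i j a b) (row i j h p q) = row i j h (x \<oplus>\<^bsub>R\<^esub> p) (z \<oplus>\<^bsub>R\<^esub> q)"
    using AB[OF ab] r1 s1 by (blast intro: I.I_l_closed I.I_r_closed I.a_inv_closed)
qed

text \<open>Transvections with exactly one index in {i, j} centralise the element modulo
  \<open>rel I\<close> by \<open>acts_triv_y\<close>; \<open>t i j\<close> and \<open>t j i\<close>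
  are commutators of such transvections; those on disjoint indices commute with it outright.
  Together they generate \<open>G\<close>.\<close>

lemma y_central:
  assumes ij: "i \<in> Ix" "j \<in> Ix" "i \<noteq> j" and ab: "a \<in> A" "b \<in> B"
  shows "y i j a b \<in> cent (rel I) (carrier G)"
proof -
  let ?y = "y i j a b"
  have abc: "a \<in> carrier R" "b \<in> carrier R"
    using ab A.Icarr B.Icarr by auto
  have y: "?y \<in> carrier G"
    using ij abc by simp
  define C where "C = cent (rel I) {?y}"
  have C: "subgroup C G"
    unfolding C_def using y by (intro cent_subgroup rel_normal I) auto
  have one_common: "t k l d \<in> C"
    if "k \<in> Ix" "l \<in> Ix" "k \<in> {i, j} \<longleftrightarrow> l \<notin> {i, j}" "d \<in> carrier R" for k l d
  proof -
    have "k \<noteq> l"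
      using that(3) by blast
    moreover have "commutator G ?y (t k l d) \<in> rel I"
      using acts_triv_commutator[OF I acts_triv_y[OF ij ab] y ij that] El_subset_rel[OF I] by blast
    ultimately show ?thesis
      using that y by (simp add: C_def cent_def commutator_sym_mem[OF rel_subgroup[OF I]])
  qed
  obtain h where h: "h \<in> Ix" "h \<noteq> i" "h \<noteq> j"
    by (rule ex_third)
  have comm: "commutator G g g' \<in> C" if "g \<in> C" "g' \<in> C" for g g'
    unfolding commutator_def using C that by (intro subgroup.m_closed subgroup.m_inv_closed)
  have "t k l d \<in> C" if kl: "k \<in> Ix" "l \<in> Ix" "k \<noteq> l" "d \<in> carrier R" for k l d
  proof -
    consider "k = i" "l = j" | "k = j" "l = i" | "{k, l} \<inter> {i, j} = {}" | "k \<in> {i, j} \<longleftrightarrow> l \<notin> {i, j}"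
      using kl by blast
    then show ?thesis
    proof cases
      case 1
      then show ?thesis
        using kl h ij by (auto simp: t_eq_commutator[of i j h] intro!: comm one_common)
    next
      case 2
      then show ?thesis
        using kl h ij by (auto simp: t_eq_commutator[of j i h] intro!: comm one_common)
    next
      case 3
      then have "conjg (t k l d) ?y = ?y"
        using kl ij abc by (simp add: conjg_t_y_disjoint)
      then have "commutator G (t k l d) ?y = \<one>"
        using kl y by (simp add: commutator_def conjg_def)
      then show ?thesis
        using kl subgroup.one_closed[OF rel_subgroup[OF I]] by (simp add: C_def cent_def)
    next
      case 4
      then show ?thesis using one_common kl by blast
    qed
  qed
  then have "generate G {t i j c | i j c. i \<in> Ix \<and> j \<in> Ix \<and> i \<noteq> j \<and> c \<in> carrier R} \<subseteq> C"
    using C by (intro generate_subgroup_incl) auto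
  then have "carrier G \<subseteq> C"
    using generated by simp
  then have "{?y} \<subseteq> cent (rel I) (carrier G)"
    unfolding C_def using y by - (rule cent_swap[OF rel_subgroup[OF I]], auto)
  then show ?thesis
    by simp
qed

text \<open>Write \<open>t i j a\<close> as [u, v] with u = \<open>t i h a\<close> and v =
  \<open>t h j\<close> at 1, and let w = \<open>t j i b\<close>, so that [v, w] =
  \<open>t h i b\<close>. The degenerate Hall--Witt identity makes [[u, v], w] conjugate to [u,
  [v, w]] modulo \<open>rel I\<close>.\<close>

lemma y_shift:
  assumes ij: "i \<in> Ix" "j \<in> Ix" "i \<noteq> j" and h: "h \<in> Ix" "h \<noteq> i" and ab: "a \<in> A" "b \<in> B"
  shows "rel I #> y i j a b = rel I #> y i h a b"
proof (cases "h = j")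
  case False
  have abc: "a \<in> carrier R" "b \<in> carrier R"
    using ab A.Icarr B.Icarr by auto
  have N: "rel I \<lhd> G"
    by (rule rel_normal[OF I])
  interpret Q: group_hom G "G Mod rel I" "\<lambda>x. rel I #> x"
    by (rule group_hom_Mod[OF N])
  let ?u = "t i h a" and ?v = "t h j \<one>\<^bsub>R\<^esub>" and ?w = "t j i b"
  have uv: "commutator G ?u ?v = t i j a"
    using ij h abc False by (simp add: commutator_t)
  have vw: "commutator G ?v ?w = t h i b"
    using ij h abc False by (simp add: commutator_t)
  \<comment> \<open>The parameter ba lies in \<open>I\<close>, so \<open>?u\<close> and
    \<open>?w\<close> commute in the quotient.\<close>
  have "commutator G ?w ?u = t j h (b \<otimes>\<^bsub>R\<^esub> a)"
    using ij h abc False by (simp add: commutator_t)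
  then have "commutator G ?w ?u \<in> rel I"
    using ij h AB[OF ab] False by (simp add: t_in_rel[OF I])
  then have "commutator G ?u ?w \<in> rel I"
    using ij h abc by - (rule commutator_sym_mem[OF rel_subgroup[OF I]], auto)
  then have "(rel I #> ?u) \<otimes>\<^bsub>G Mod rel I\<^esub> (rel I #> ?w) = (rel I #> ?w) \<otimes>\<^bsub>G Mod rel I\<^esub> (rel I #> ?u)"
    using ij h abc by (simp add: rcos_commute_iff[OF N])
  moreover have "(rel I #> t h i b) \<otimes>\<^bsub>G Mod rel I\<^esub> (rel I #> ?v) = (rel I #> ?v) \<otimes>\<^bsub>G Mod rel I\<^esub> (rel I #> t h i b)"
    using ij h abc False t_commute[of h i h j b "\<one>\<^bsub>R\<^esub>"] by (simp flip: Q.hom_mult)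
  ultimately obtain g where g: "g \<in> carrier (G Mod rel I)"
    and "commutator (G Mod rel I) (rel I #> t i j a) (rel I #> ?w)
      = Q.H.conjg g (commutator (G Mod rel I) (rel I #> ?u) (rel I #> t h i b))"
    using Q.H.hall_witt_degenerate[of "rel I #> ?u" "rel I #> ?v" "rel I #> ?w"] ij h abc False
    by (auto simp: uv vw simp flip: Q.hom_commutator)
  then have *: "rel I #> y i j a b = Q.H.conjg g (rel I #> y i h a b)"
    using ij h abc False by (simp add: y_def flip: Q.hom_commutator)
  obtain x where x: "x \<in> carrier G" "g = rel I #> x"
    using g by (auto simp: FactGroup_def RCOSETS_def)
  have y: "y i h a b \<in> carrier G"
    using ij h abc by simp
  \<comment> \<open>Centrality modulo \<open>rel I\<close> removes the unknown conjugating element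
    \<open>g\<close>.\<close>
  have "commutator G (y i h a b) x \<in> rel I"
    using y_central[OF ij(1) h(1) _ ab] h x by (auto simp: cent_def)
  then have "(rel I #> y i h a b) \<otimes>\<^bsub>G Mod rel I\<^esub> g = g \<otimes>\<^bsub>G Mod rel I\<^esub> (rel I #> y i h a b)"
    using x y by (simp add: rcos_commute_iff[OF N])
  then have "Q.H.conjg g (rel I #> y i h a b) = rel I #> y i h a b"
    using g y by (simp add: Q.H.conjg_def Q.H.m_assoc flip: \<open>_ = g \<otimes>\<^bsub>G Mod rel I\<^esub> _\<close>)
  then show ?thesis
    using * by simp
qed auto

end

text \<open>\<open>y_shift\<close> moves the second index. Inverting via \<open>y_swap\<close>,
  which exchanges the ideals, moves the first.\<close>

lemma y_coset:
  assumes ideals: "ideal A R" "ideal B R" "ideal I R"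
    and AB: "\<And>a b. \<lbrakk>a \<in> A; b \<in> B\<rbrakk> \<Longrightarrow> a \<otimes>\<^bsub>R\<^esub> b \<in> I \<and> b \<otimes>\<^bsub>R\<^esub> a \<in> I"
    and ab: "a \<in> A" "b \<in> B"
    and ij: "i \<in> Ix" "j \<in> Ix" "i \<noteq> j" and kl: "k \<in> Ix" "l \<in> Ix" "k \<noteq> l"
  shows "rel I #> y i j a b = rel I #> y k l a b"
proof -
  have abc: "a \<in> carrier R" "b \<in> carrier R"
    using ideal.Icarr[OF ideals(1) ab(1)] ideal.Icarr[OF ideals(2) ab(2)] by auto
  interpret Q: group_hom G "G Mod rel I" "\<lambda>x. rel I #> x"
    by (intro group_hom_Mod rel_normal ideals)
  have right: "rel I #> y p q a b = rel I #> y p r a b"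
    if "p \<in> Ix" "q \<in> Ix" "p \<noteq> q" "r \<in> Ix" "r \<noteq> p" for p q r
    using that ideals AB ab by (intro y_shift) auto
  have left: "rel I #> y p q a b = rel I #> y r q a b"
    if pqr: "p \<in> Ix" "q \<in> Ix" "p \<noteq> q" "r \<in> Ix" "r \<noteq> q" for p q r
  proof -
    have "rel I #> y q p b a = rel I #> y q r b a"
      using pqr ideals AB ab by (intro y_shift[of B A]) auto
    then show ?thesis
      using pqr abc by (simp add: y_swap[of q p b a] y_swap[of q r b a] Q.hom_inv)
  qed
  obtain h where h: "h \<in> Ix" "h \<noteq> i" "h \<noteq> j"
    by (rule ex_third)
  consider "l \<noteq> i" | "k \<noteq> j" | "l = i" "k = j"
    by blast
  then show ?thesis
  proof cases
    case 1
    then show ?thesis using right[of i j l] left[of i l k] ij kl by auto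
  next
    case 2
    then show ?thesis using left[of i j k] right[of k j l] ij kl by auto
  next
    \<comment> \<open>The reversed pair needs a detour through a third index: (i, j), (i, h), (j,
      h), (j, i).\<close>
    case 3
    then show ?thesis using right[of i j h] left[of i h j] right[of j h i] ij h by auto
  qed
qed

section \<open>Mixed commutator subgroups\<close>

abbreviation mixed :: "'r set \<Rightarrow> 'r set \<Rightarrow> 'g set" where
  "mixed A B \<equiv> commutator_subgroup G (El A) (El B)"

lemma mixed_subgroup: "\<lbrakk>ideal A R; ideal B R\<rbrakk> \<Longrightarrow> subgroup (mixed A B) G"
  by (intro commutator_subgroup_is_subgroup El_subset)

text \<open>Conjugate \<open>t i j\<close> at ab, written as [\<open>t i h a\<close>,
  \<open>t h j b\<close>], by \<open>t j i c\<close>. Neither entry is opposite to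
  \<open>t j i c\<close>, so both stay in their elementary subgroups.\<close>

lemma z_mult_commutator:
  assumes A: "ideal A R" and B: "ideal B R" and ab: "a \<in> A" "b \<in> B"
    and ij: "i \<in> Ix" "j \<in> Ix" "i \<noteq> j" and c: "c \<in> carrier R"
  shows "\<exists>u\<in>El A. \<exists>v\<in>El B. z i j c (a \<otimes>\<^bsub>R\<^esub> b) = commutator G u v"
proof -
  obtain h where h: "h \<in> Ix" "h \<noteq> i" "h \<noteq> j"
    by (rule ex_third)
  have abc: "a \<in> carrier R" "b \<in> carrier R"
    using ideal.Icarr[OF A ab(1)] ideal.Icarr[OF B ab(2)] by auto
  have "z i j c (a \<otimes>\<^bsub>R\<^esub> b) = conjg (t j i c) (commutator G (t i h a) (t h j b))"
    using ij h abc by (simp add: commutator_t z_def)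
  also have "\<dots> = commutator G (conjg (t j i c) (t i h a)) (conjg (t j i c) (t h j b))"
    using ij h abc c by (simp add: conjg_commutator)
  finally have z: "z i j c (a \<otimes>\<^bsub>R\<^esub> b) = \<dots>" .
  have "conjg (t j i c) (t i h a) = t j h (c \<otimes>\<^bsub>R\<^esub> a) \<otimes> t i h a"
    using ij h abc c by (intro conjg_t_left) auto
  also have "\<dots> \<in> El A"
    using ij h c ab by (intro subgroup.m_closed[OF El_subgroup[OF A]] t_in_El ideal.I_l_closed[OF A]) auto
  moreover have "conjg (t j i c) (t h j b) = t h i (\<ominus>\<^bsub>R\<^esub> (b \<otimes>\<^bsub>R\<^esub> c)) \<otimes> t h j b"
    using ij h abc c by (intro conjg_t_right) auto
  moreover have "\<dots> \<in> El B"
    using ij h c ab by (intro subgroup.m_closed[OF El_subgroup[OF B]] t_in_El ideal.I_r_closed[OF B]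
        additive_subgroup.a_inv_closed[OF ideal.axioms(1)[OF B]]) auto
  ultimately show ?thesis
    using z by auto
qed

text \<open>\<open>z i j c x\<close> is additive in \<open>x\<close>, so products suffice. For ba
  the commutator comes with its entries exchanged and is inverted.\<close>

lemma rel_subset_mixed:
  assumes A: "ideal A R" and B: "ideal B R"
  shows "rel (symm_prod R A B) \<subseteq> mixed A B"
proof (rule rel_minimal)
  show "ideal (symm_prod R A B) R"
    using A B by (rule R.symm_prod_ideal)
  show sub: "subgroup (mixed A B) G"
    using A B by (rule mixed_subgroup)
  fix i j c x assume ij: "i \<in> Ix" "j \<in> Ix" "i \<noteq> j" and c: "c \<in> carrier R" and x: "x \<in> symm_prod R A B"
  have "symm_prod R A B \<subseteq> {x \<in> carrier R. z i j c x \<in> mixed A B}"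
  proof (rule R.symm_prod_minimal)
    fix a b assume ab: "a \<in> A" "b \<in> B"
    have abc: "a \<in> carrier R" "b \<in> carrier R"
      using ideal.Icarr[OF A ab(1)] ideal.Icarr[OF B ab(2)] by auto
    have "z i j c (a \<otimes>\<^bsub>R\<^esub> b) \<in> mixed A B"
      using z_mult_commutator[OF A B ab ij c] commutator_subgroup_incl by force
    moreover have "z i j c (b \<otimes>\<^bsub>R\<^esub> a) \<in> mixed A B"
    proof -
      obtain u v where uv: "u \<in> El A" "v \<in> El B" "z i j c (b \<otimes>\<^bsub>R\<^esub> a) = commutator G v u"
        using z_mult_commutator[OF B A ab(2,1) ij c] by blast
      then have "commutator G u v \<in> mixed A B"
        by (simp add: commutator_subgroup_incl)
      then show ?thesis
        using uv(1,2) El_subset[OF A] El_subset[OF B] unfolding uv(3)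
        by - (rule commutator_sym_mem[OF sub], auto)
    qed
    ultimately show "a \<otimes>\<^bsub>R\<^esub> b \<in> {x \<in> carrier R. z i j c x \<in> mixed A B} \<and>
        b \<otimes>\<^bsub>R\<^esub> a \<in> {x \<in> carrier R. z i j c x \<in> mixed A B}"
      using abc by simp
  next
    fix a b assume "a \<in> {x \<in> carrier R. z i j c x \<in> mixed A B}" "b \<in> {x \<in> carrier R. z i j c x \<in> mixed A B}"
    then show "a \<oplus>\<^bsub>R\<^esub> b \<in> {x \<in> carrier R. z i j c x \<in> mixed A B}"
      using ij c subgroup.m_closed[OF sub] by (simp add: z_def t_add conjg_mult)
  qed
  then show "z i j c x \<in> mixed A B"
    using x by blast
qed

text \<open>A commutator of two transvections is trivial, a transvection over \<open>I\<close> or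
  the inverse of one, or some \<open>y i j a b\<close>. The later applications take \<open>P\<close>
  to be a normal \<open>cent\<close>.\<close>

lemma mixed_subset_normal:
  assumes A: "ideal A R" and B: "ideal B R" and I: "ideal I R" and P: "P \<lhd> G"
    and AB: "\<And>a b. \<lbrakk>a \<in> A; b \<in> B\<rbrakk> \<Longrightarrow> a \<otimes>\<^bsub>R\<^esub> b \<in> I \<and> b \<otimes>\<^bsub>R\<^esub> a \<in> I"
    and rel: "rel I \<subseteq> P"
    and y: "\<And>i j a b. \<lbrakk>i \<in> Ix; j \<in> Ix; i \<noteq> j; a \<in> A; b \<in> B\<rbrakk> \<Longrightarrow> y i j a b \<in> P"
  shows "mixed A B \<subseteq> P"
proof (rule commutator_subgroup_subset)
  show sub: "subgroup P G"
    using P by (rule normal_imp_subgroup)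
  have P_t: "t i j x \<in> P" if "i \<in> Ix" "j \<in> Ix" "i \<noteq> j" "x \<in> I" for i j x
    using t_in_rel[OF I] rel that by blast
  have gen: "commutator G (t i j a) (t k l b) \<in> P"
    if ij: "i \<in> Ix" "j \<in> Ix" "i \<noteq> j" and kl: "k \<in> Ix" "l \<in> Ix" "k \<noteq> l" and ab: "a \<in> A" "b \<in> B"
    for i j k l a b
  proof -
    have abc: "a \<in> carrier R" "b \<in> carrier R"
      using ideal.Icarr[OF A ab(1)] ideal.Icarr[OF B ab(2)] by auto
    consider "j \<noteq> k" "i \<noteq> l" | "j = k" "i \<noteq> l" | "j \<noteq> k" "i = l" | "j = k" "i = l"
      by blast
    then show ?thesis
    proof cases
      case 1
      then show ?thesis
        using ij kl abc subgroup.one_closed[OF sub] by (simp add: commutator_t_one)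
    next
      case 2
      then show ?thesis
        using ij kl abc AB[OF ab] P_t by (simp add: commutator_t)
    next
      case 3
      then have "commutator G (t k l b) (t i j a) \<in> P"
        using ij kl abc AB[OF ab] P_t by (simp add: commutator_t)
      then show ?thesis
        using ij kl abc by - (rule commutator_sym_mem[OF sub], auto)
    next
      case 4
      then show ?thesis
        using y[OF ij ab] by (simp add: y_def)
    qed
  qed
  fix u v assume "u \<in> El A" "v \<in> El B"
  then show "commutator G u v \<in> P"
    unfolding El_def
    by (rule commutator_generate_mem[OF P t_generators_subset t_generators_subset, rotated 3])
      (use gen ideal_subset A B in auto)
qed

text \<open>The subgroup lies between \<open>rel ?I\<close> and the preimage of the centre of the
  quotient by \<open>rel ?I\<close>.\<close>

lemma mixed_normal:
  assumes A: "ideal A R" and B: "ideal B R"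
  shows "mixed A B \<lhd> G"
proof (rule normal_if_central_mod)
  let ?I = "symm_prod R A B"
  show I: "rel ?I \<lhd> G"
    using A B by (intro rel_normal R.symm_prod_ideal)
  show "subgroup (mixed A B) G"
    using A B by (rule mixed_subgroup)
  show "rel ?I \<subseteq> mixed A B"
    using A B by (rule rel_subset_mixed)
  show "mixed A B \<subseteq> cent (rel ?I) (carrier G)"
  proof (rule mixed_subset_normal[OF A B])
    show "cent (rel ?I) (carrier G) \<lhd> G"
      using I by (intro cent_normal) auto
    show "rel ?I \<subseteq> cent (rel ?I) (carrier G)"
      using commutator_mem_normal(1)[OF I] normal_imp_subgroup[OF I, THEN subgroup.subset]
      by (auto simp: cent_def)
    fix i j a b assume "i \<in> Ix" "j \<in> Ix" "i \<noteq> j" "a \<in> A" "b \<in> B"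
    then show "y i j a b \<in> cent (rel ?I) (carrier G)"
      using A B R.mult_mem_symm_prod by (intro y_central[of A B] R.symm_prod_ideal) auto
  qed (use A B in \<open>auto intro!: R.symm_prod_ideal dest: R.mult_mem_symm_prod\<close>)
qed

text \<open>The conjugation by \<open>t l k c\<close> inside \<open>z k l c b\<close> is moved to
  \<open>t i j a\<close>. This keeps \<open>t i j a\<close> in \<open>El A\<close> except when the
  two are opposite, which \<open>ne\<close> excludes.\<close>

lemma commutator_t_z_mem:
  assumes A: "ideal A R" and B: "ideal B R" and N: "N \<lhd> G"
    and El: "\<And>u v. \<lbrakk>u \<in> El A; v \<in> El B\<rbrakk> \<Longrightarrow> commutator G u v \<in> N"
    and ij: "i \<in> Ix" "j \<in> Ix" "i \<noteq> j" and kl: "k \<in> Ix" "l \<in> Ix" "k \<noteq> l"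
    and ab: "a \<in> A" "b \<in> B" and c: "c \<in> carrier R" and ne: "(i, j) \<noteq> (k, l)"
  shows "commutator G (t i j a) (z k l c b) \<in> N"
proof -
  have abc: "a \<in> carrier R" "b \<in> carrier R"
    using ideal.Icarr[OF A ab(1)] ideal.Icarr[OF B ab(2)] by auto
  have "conjg (t l k (\<ominus>\<^bsub>R\<^esub> c)) (t i j a) \<in> El A"
  proof -
    consider "l \<noteq> j" "k \<noteq> i" | "k = i" "l \<noteq> j" | "k \<noteq> i" "l = j"
      using ne by blast
    then show ?thesis
    proof cases
      case 1
      then show ?thesis using ij kl abc c ab by (simp add: conjg_t_one t_in_El)
    next
      case 2
      then have "conjg (t l k (\<ominus>\<^bsub>R\<^esub> c)) (t i j a) = t l j (\<ominus>\<^bsub>R\<^esub> c \<otimes>\<^bsub>R\<^esub> a) \<otimes> t i j a"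
        using ij kl abc c by (simp add: conjg_t_left)
      then show ?thesis
        using 2 ij kl ab c by (auto intro!: subgroup.m_closed[OF El_subgroup[OF A]] t_in_El ideal.I_l_closed[OF A])
    next
      case 3
      then have "conjg (t l k (\<ominus>\<^bsub>R\<^esub> c)) (t i j a) = t i k (\<ominus>\<^bsub>R\<^esub> (a \<otimes>\<^bsub>R\<^esub> \<ominus>\<^bsub>R\<^esub> c)) \<otimes> t i j a"
        using ij kl abc c by (auto simp: conjg_t_right)
      then show ?thesis
        using 3 ij kl ab c by (auto intro!: subgroup.m_closed[OF El_subgroup[OF A]] t_in_El ideal.I_r_closed[OF A]
            additive_subgroup.a_inv_closed[OF ideal.axioms(1)[OF A]])
    qed
  qed
  then have "commutator G (conjg (t l k (\<ominus>\<^bsub>R\<^esub> c)) (t i j a)) (t k l b) \<in> N"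
    using El t_in_El kl ab by blast
  then have "conjg (t l k c) (commutator G (conjg (t l k (\<ominus>\<^bsub>R\<^esub> c)) (t i j a)) (t k l b)) \<in> N"
    using N kl c by (simp add: conjg_mem_normal)
  then show ?thesis
    using ij kl abc c by (simp add: conjg_commutator conjg_inv_cancel z_def flip: t_inv)
qed

text \<open>Commutator bounds pass from elementary subgroups to their normal closures. The case left
  open by \<open>commutator_t_z_mem\<close> writes \<open>t i j a\<close> as [u, v] through a third
  index and applies \<open>commutator_commutator_mem_normal\<close>.\<close>

lemma commutator_rel_mem:
  assumes A: "ideal A R" and B: "ideal B R" and N: "N \<lhd> G"
    and El: "\<And>u v. \<lbrakk>u \<in> El A; v \<in> El B\<rbrakk> \<Longrightarrow> commutator G u v \<in> N"
    and uv: "u \<in> rel A" "v \<in> rel B"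
  shows "commutator G u v \<in> N"
proof -
  have sub: "subgroup N G"
    using N by (rule normal_imp_subgroup)
  have t_z: "commutator G (t i j a) (z k l c b) \<in> N"
    if ij: "i \<in> Ix" "j \<in> Ix" "i \<noteq> j" and kl: "k \<in> Ix" "l \<in> Ix" "k \<noteq> l"
      and ab: "a \<in> A" "b \<in> B" and c: "c \<in> carrier R" for i j k l a b c
  proof (cases "(i, j) = (k, l)")
    case False
    then show ?thesis
      using A B N El ij kl ab c by (intro commutator_t_z_mem)
  next
    case True
    have abc: "a \<in> carrier R" "b \<in> carrier R"
      using ideal.Icarr[OF A ab(1)] ideal.Icarr[OF B ab(2)] by auto
    obtain h where h: "h \<in> Ix" "h \<noteq> i" "h \<noteq> j"
      by (rule ex_third)
    let ?u = "t i h a" and ?v = "t h j \<one>\<^bsub>R\<^esub>" and ?w = "z i j c b"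
    define \<beta> where "\<beta> = commutator G ?w ?v"
    have w: "?w \<in> carrier G"
      using ij abc c by simp
    \<comment> \<open>\<open>?v\<close> has exactly one index in {i, j}, and \<open>?w\<close> acts
      trivially modulo \<open>B\<close> on such transvections.\<close>
    have \<beta>: "\<beta> \<in> El B"
      unfolding \<beta>_def using h ij w c ab
      by (intro acts_triv_commutator[OF B, of i j] acts_triv_z[OF B]) auto
    then have \<beta>c: "\<beta> \<in> carrier G"
      using El_subset[OF B] by blast
    have uv: "commutator G ?u ?v = t i j a"
      using ij h abc by (simp add: commutator_t)
    have "commutator G ?u ?w \<in> N"
      using A B N El ij h ab c by (intro commutator_t_z_mem) auto
    moreover have "commutator G ?u \<beta> \<in> N"
      using El \<beta> ab ij h by (simp add: t_in_El)
    moreover have "commutator G (t i j a) \<beta> \<in> N"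
      using El \<beta> ab ij by (simp add: t_in_El)
    then have "commutator G \<beta> (t i j a) \<in> N"
      using ij abc \<beta>c by - (rule commutator_sym_mem[OF sub], auto)
    ultimately have "commutator G (t i j a) ?w \<in> N"
      using commutator_commutator_mem_normal[OF N, of ?u ?v ?w] ij h abc w by (simp add: uv \<beta>_def)
    then show ?thesis
      using True by simp
  qed
  have t_rel: "commutator G x v \<in> N" if "x \<in> El A" "v \<in> rel B" for x v
    using that unfolding El_def rel_def
    by (rule commutator_generate_mem[OF N t_generators_subset z_generators_subset, rotated 3])
      (use t_z ideal_subset A B in auto)
  have relc: "rel B \<subseteq> carrier G"
    by (rule rel_subset[OF B])
  \<comment> \<open>Since \<open>rel B\<close> is normal, so is its centraliser modulo
    \<open>N\<close>; the conjugates generating \<open>rel A\<close> thus reduce to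
    transvections.\<close>
  have "rel A \<subseteq> cent N (rel B)"
  proof (rule rel_minimal_normal[OF A])
    show "cent N (rel B) \<lhd> G"
      using rel_normal[OF B] relc by (intro cent_normal N conjg_mem_normal)
    fix i j a assume ij: "i \<in> Ix" "j \<in> Ix" "i \<noteq> j" "a \<in> A"
    then show "t i j a \<in> cent N (rel B)"
      using t_rel t_in_El ideal.Icarr[OF A] by (auto simp: cent_def)
  qed
  then show ?thesis
    using uv by (auto simp: cent_def)
qed

text \<open>The element is central modulo \<open>rel J\<close>, so its whole coset is invariant
  under conjugation. Unlike a singleton, the coset therefore satisfies the invariance condition of
  \<open>cent_normal\<close>.\<close>

lemma conjg_y_coset:
  assumes C: "ideal C R" and D: "ideal D R" and J: "ideal J R"
    and CD: "\<And>c d. \<lbrakk>c \<in> C; d \<in> D\<rbrakk> \<Longrightarrow> c \<otimes>\<^bsub>R\<^esub> d \<in> J \<and> d \<otimes>\<^bsub>R\<^esub> c \<in> J"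
    and kl: "k \<in> Ix" "l \<in> Ix" "k \<noteq> l" and cd: "c \<in> C" "d \<in> D"
    and g: "g \<in> carrier G" and s: "s \<in> rel J #> y k l c d"
  shows "conjg g s \<in> rel J #> y k l c d"
proof -
  have yc: "y k l c d \<in> carrier G"
    using kl ideal.Icarr[OF C cd(1)] ideal.Icarr[OF D cd(2)] by simp
  have J': "rel J \<lhd> G"
    by (rule rel_normal[OF J])
  obtain f where f: "f \<in> rel J" "s = f \<otimes> y k l c d"
    using s by (auto simp: r_coset_def)
  have fc: "f \<in> carrier G"
    using f rel_subset[OF J] by blast
  have "commutator G (y k l c d) g \<in> rel J"
    using y_central[OF C D J CD kl cd] g by (auto simp: cent_def)
  then have "commutator G g (y k l c d) \<in> rel J"
    using g yc by - (rule commutator_sym_mem[OF rel_subgroup[OF J]], auto)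
  then have "conjg g f \<otimes> commutator G g (y k l c d) \<in> rel J"
    using f g J' by (intro subgroup.m_closed[OF rel_subgroup[OF J]] conjg_mem_normal)
  moreover have "conjg g s = conjg g f \<otimes> commutator G g (y k l c d) \<otimes> y k l c d"
    using f(2) fc yc g by (simp add: word_simps)
  ultimately show ?thesis
    using rel_subset[OF J] yc by (auto intro: rcosI)
qed

text \<open>The centraliser of the coset modulo \<open>N\<close> is normal, so \<open>u\<close> may
  be a transvection \<open>t i j x\<close>. The coset has a representative on indices disjoint from
  {i, j}, and the remaining factor from \<open>rel J\<close> is handled by
  \<open>IJ\<close>.\<close>

lemma t_commutator_y_coset:
  assumes I: "ideal I R" and C: "ideal C R" and D: "ideal D R" and J: "ideal J R"
    and CD: "\<And>c d. \<lbrakk>c \<in> C; d \<in> D\<rbrakk> \<Longrightarrow> c \<otimes>\<^bsub>R\<^esub> d \<in> J \<and> d \<otimes>\<^bsub>R\<^esub> c \<in> J"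
    and N: "N \<lhd> G" and IJ: "\<And>u v. \<lbrakk>u \<in> rel I; v \<in> rel J\<rbrakk> \<Longrightarrow> commutator G u v \<in> N"
    and kl: "k \<in> Ix" "l \<in> Ix" "k \<noteq> l" and cd: "c \<in> C" "d \<in> D"
    and u: "u \<in> rel I" and s: "s \<in> rel J #> y k l c d"
  shows "commutator G u s \<in> N"
proof -
  have cdc: "c \<in> carrier R" "d \<in> carrier R"
    using ideal.Icarr[OF C cd(1)] ideal.Icarr[OF D cd(2)] by auto
  let ?S = "rel J #> y k l c d"
  have S: "?S \<subseteq> carrier G"
    using rel_subset[OF J] kl cdc by (intro r_coset_subset_G) auto
  have "rel I \<subseteq> cent N ?S"
  proof (rule rel_minimal_normal[OF I])
    show "cent N ?S \<lhd> G"
      using N S conjg_y_coset[OF C D J CD kl cd] by (rule cent_normal)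
    fix i j x assume ij: "i \<in> Ix" "j \<in> Ix" "i \<noteq> j" and x: "x \<in> I"
    have xc: "x \<in> carrier R"
      using ideal.Icarr[OF I x] .
    obtain k' l' where kl': "k' \<in> Ix" "l' \<in> Ix" "k' \<noteq> l'" "{k', l'} \<inter> {i, j} = {}"
      by (rule ex_disjoint_pair)
    have S': "?S = rel J #> y k' l' c d"
      using C D J CD cd kl kl'(1-3) by (rule y_coset)
    have "commutator G s (t i j x) \<in> N" if s: "s \<in> ?S" for s
    proof -
      obtain f where f: "f \<in> rel J" "s = f \<otimes> y k' l' c d"
        using s unfolding S' by (auto simp: r_coset_def)
      have fc: "f \<in> carrier G"
        using f rel_subset[OF J] by blast
      have "conjg (t i j x) (y k' l' c d) = y k' l' c d"
        using ij kl' xc cdc by (intro conjg_t_y_disjoint) auto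
      then have "commutator G (t i j x) (y k' l' c d) = \<one>"
        using ij xc kl' cdc by (simp add: commutator_def conjg_def)
      then have "commutator G (y k' l' c d) (t i j x) = \<one>"
        using ij xc kl' cdc by (simp add: commutator_swap[of "t i j x"])
      then have "commutator G s (t i j x) = commutator G f (t i j x)"
        using f fc ij xc kl' cdc by (simp add: commutator_mult_left)
      moreover have "commutator G (t i j x) f \<in> N"
        using IJ f t_in_rel[OF I] ij x by blast
      then have "commutator G f (t i j x) \<in> N"
        using ij xc fc by - (rule commutator_sym_mem[OF normal_imp_subgroup[OF N]], auto)
      ultimately show ?thesis
        by simp
    qed
    then have "?S \<subseteq> cent N {t i j x}"
      using S by (auto simp: cent_def)
    then have "{t i j x} \<subseteq> cent N ?S"
      using ij xc by - (rule cent_swap[OF normal_imp_subgroup[OF N]], auto)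
    then show "t i j x \<in> cent N ?S"
      by simp
  qed
  then show ?thesis
    using u s by (auto simp: cent_def)
qed

theorem mixed_mixed:
  assumes A: "ideal A R" and B: "ideal B R" and C: "ideal C R" and D: "ideal D R"
  shows "commutator_subgroup G (mixed A B) (mixed C D) = mixed (symm_prod R A B) (symm_prod R C D)"
proof
  let ?I = "symm_prod R A B" and ?J = "symm_prod R C D"
  let ?N = "mixed ?I ?J"
  have I: "ideal ?I R" and J: "ideal ?J R"
    using A B C D by (simp_all add: R.symm_prod_ideal)
  \<comment> \<open>The easy inclusion: \<open>El ?I\<close> lies in \<open>rel ?I\<close>, which
    lies in \<open>mixed A B\<close>, and similarly for \<open>?J\<close>.\<close>
  show "?N \<subseteq> commutator_subgroup G (mixed A B) (mixed C D)"
    using El_subset_rel[OF I] El_subset_rel[OF J] rel_subset_mixed[OF A B] rel_subset_mixed[OF C D]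
    by (intro commutator_subgroup_mono) auto
  have N: "?N \<lhd> G"
    using I J by (rule mixed_normal)
  have N_sub: "subgroup ?N G"
    using N by (rule normal_imp_subgroup)
  have IJ: "commutator G u v \<in> ?N" if "u \<in> rel ?I" "v \<in> rel ?J" for u v
    using I J N _ that by (rule commutator_rel_mem) (rule commutator_subgroup_incl)
  have JI: "commutator G v u \<in> ?N" if uv: "v \<in> rel ?J" "u \<in> rel ?I" for u v
    using IJ[OF uv(2,1)] uv rel_subset[OF I] rel_subset[OF J]
    by - (rule commutator_sym_mem[OF N_sub], auto)
  have AB: "a \<otimes>\<^bsub>R\<^esub> b \<in> ?I \<and> b \<otimes>\<^bsub>R\<^esub> a \<in> ?I" if "a \<in> A" "b \<in> B" for a b
    using A B that by (rule R.mult_mem_symm_prod)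
  have CD: "c \<otimes>\<^bsub>R\<^esub> d \<in> ?J \<and> d \<otimes>\<^bsub>R\<^esub> c \<in> ?J" if "c \<in> C" "d \<in> D" for c d
    using C D that by (rule R.mult_mem_symm_prod)
  have relJ: "rel ?J \<subseteq> carrier G" and relI: "rel ?I \<subseteq> carrier G"
    using rel_subset I J by auto
  have H: "mixed A B \<lhd> G"
    using A B by (rule mixed_normal)
  have Hc: "mixed A B \<subseteq> carrier G"
    using normal_imp_subgroup[OF H] by (rule subgroup.subset)
  have y_AB: "y i j a b \<in> carrier G \<and> y i j a b \<in> rel ?I #> y i j a b"
    if "i \<in> Ix" "j \<in> Ix" "i \<noteq> j" "a \<in> A" "b \<in> B" for i j a b
    using that ideal.Icarr[OF A] ideal.Icarr[OF B] rel_subgroup[OF I] by (simp add: rcos_self)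
  have y_CD: "y i j c d \<in> carrier G \<and> y i j c d \<in> rel ?J #> y i j c d"
    if "i \<in> Ix" "j \<in> Ix" "i \<noteq> j" "c \<in> C" "d \<in> D" for i j c d
    using that ideal.Icarr[OF C] ideal.Icarr[OF D] rel_subgroup[OF J] by (simp add: rcos_self)
  have rel_y: "commutator G u s \<in> ?N"
    if "k \<in> Ix" "l \<in> Ix" "k \<noteq> l" "c \<in> C" "d \<in> D" "u \<in> rel ?I" "s \<in> rel ?J #> y k l c d" for k l c d u s
    using I C D J CD N IJ that by (rule t_commutator_y_coset)
  have y_rel: "commutator G u s \<in> ?N"
    if "i \<in> Ix" "j \<in> Ix" "i \<noteq> j" "a \<in> A" "b \<in> B" "u \<in> rel ?J" "s \<in> rel ?I #> y i j a b" for i j a b u s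
    using J A B I AB N JI that by (rule t_commutator_y_coset)
  have y_y: "commutator G (y i j a b) (y k l c d) \<in> ?N"
    if ij: "i \<in> Ix" "j \<in> Ix" "i \<noteq> j" and ab: "a \<in> A" "b \<in> B"
      and kl: "k \<in> Ix" "l \<in> Ix" "k \<noteq> l" and cd: "c \<in> C" "d \<in> D" for i j k l a b c d
  proof -
    have abc: "a \<in> carrier R" "b \<in> carrier R" "c \<in> carrier R" "d \<in> carrier R"
      using ideal.Icarr[OF A ab(1)] ideal.Icarr[OF B ab(2)]
        ideal.Icarr[OF C cd(1)] ideal.Icarr[OF D cd(2)] by auto
    obtain k' l' where kl': "k' \<in> Ix" "l' \<in> Ix" "k' \<noteq> l'" "{k', l'} \<inter> {i, j} = {}"
      by (rule ex_disjoint_pair)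
    \<comment> \<open>Replacing the index pair costs a factor \<open>f\<close> from
      \<open>rel ?J\<close>; on disjoint indices the two elementary commutators commute
      exactly.\<close>
    have "rel ?J #> y k l c d = rel ?J #> y k' l' c d"
      using C D J CD cd kl kl'(1-3) by (rule y_coset)
    then have "y k l c d \<in> rel ?J #> y k' l' c d"
      using y_CD[OF kl cd] by simp
    then obtain f where f: "f \<in> rel ?J" "y k l c d = f \<otimes> y k' l' c d"
      by (auto simp: r_coset_def)
    have fc: "f \<in> carrier G"
      using f relJ by blast
    have yc: "y i j a b \<in> carrier G" "y k' l' c d \<in> carrier G" "y k l c d \<in> carrier G"
      using ij kl kl' abc by simp_all
    have "commutator G (y k' l' c d) (y i j a b) = \<one>"
      using ij kl' abc by (rule commutator_y_disjoint)
    then have "commutator G (y k l c d) (y i j a b) = conjg f \<one> \<otimes> commutator G f (y i j a b)"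
      using yc fc by (simp add: f(2) commutator_mult_left)
    also have "\<dots> \<in> ?N"
      using y_rel[OF ij ab f(1)] y_AB[OF ij ab] fc by simp
    finally show ?thesis
      using yc by - (rule commutator_sym_mem[OF N_sub], auto)
  qed
  \<comment> \<open>This handles the part of \<open>mixed C D\<close> coming from
    \<open>rel ?J\<close>; its elementary commutators are treated next.\<close>
  have H_rel: "mixed A B \<subseteq> cent ?N (rel ?J)"
  proof (rule mixed_subset_normal[OF A B I])
    show "cent ?N (rel ?J) \<lhd> G"
      using N relJ rel_normal[OF J] by (intro cent_normal conjg_mem_normal)
    show "rel ?I \<subseteq> cent ?N (rel ?J)"
      using IJ relI by (auto simp: cent_def)
    fix i j a b assume ij: "i \<in> Ix" "j \<in> Ix" "i \<noteq> j" "a \<in> A" "b \<in> B"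
    then have "rel ?J \<subseteq> cent ?N {y i j a b}"
      using y_rel y_AB relJ by (auto simp: cent_def)
    then have "{y i j a b} \<subseteq> cent ?N (rel ?J)"
      using y_AB ij by - (rule cent_swap[OF N_sub], auto)
    then show "y i j a b \<in> cent ?N (rel ?J)"
      by simp
  qed (rule AB)
  have "mixed C D \<subseteq> cent ?N (mixed A B)"
  proof (rule mixed_subset_normal[OF C D J])
    show "cent ?N (mixed A B) \<lhd> G"
      using N Hc H by (intro cent_normal conjg_mem_normal)
    show "rel ?J \<subseteq> cent ?N (mixed A B)"
      using N_sub relJ H_rel by (rule cent_swap)
    fix k l c d assume kl: "k \<in> Ix" "l \<in> Ix" "k \<noteq> l" "c \<in> C" "d \<in> D"
    let ?S = "rel ?J #> y k l c d"
    have S: "?S \<subseteq> carrier G"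
      using relJ y_CD[OF kl] by (intro r_coset_subset_G) auto
    \<comment> \<open>The claim is strengthened from \<open>y k l c d\<close> to its coset, whose
      centraliser modulo \<open>?N\<close> is normal, as \<open>mixed_subset_normal\<close>
      demands.\<close>
    have "mixed A B \<subseteq> cent ?N ?S"
    proof (rule mixed_subset_normal[OF A B I])
      show "cent ?N ?S \<lhd> G"
        using N S conjg_y_coset[OF C D J CD kl] by (rule cent_normal)
      show "rel ?I \<subseteq> cent ?N ?S"
        using rel_y kl relI by (auto simp: cent_def)
      fix i j a b assume ij: "i \<in> Ix" "j \<in> Ix" "i \<noteq> j" "a \<in> A" "b \<in> B"
      have "commutator G s (y i j a b) \<in> ?N" if "s \<in> ?S" for s
      proof -
        obtain f where f: "f \<in> rel ?J" "s = f \<otimes> y k l c d"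
          using \<open>s \<in> ?S\<close> by (auto simp: r_coset_def)
        have fc: "f \<in> carrier G"
          using f relJ by blast
        have "commutator G (y k l c d) (y i j a b) \<in> ?N"
          using y_y[OF ij kl] y_AB[OF ij] y_CD[OF kl] by - (rule commutator_sym_mem[OF N_sub], auto)
        moreover have "commutator G f (y i j a b) \<in> ?N"
          using y_rel[OF ij f(1)] y_AB[OF ij] by blast
        ultimately show ?thesis
          using y_AB[OF ij] y_CD[OF kl] fc N
          by (simp add: f(2) commutator_mult_left conjg_mem_normal subgroup.m_closed[OF N_sub])
      qed
      then have "?S \<subseteq> cent ?N {y i j a b}"
        using S by (auto simp: cent_def)
      then have "{y i j a b} \<subseteq> cent ?N ?S"
        using y_AB[OF ij] by - (rule cent_swap[OF N_sub], auto)
      then show "y i j a b \<in> cent ?N ?S"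
        by simp
    qed (rule AB)
    then have "{y k l c d} \<subseteq> cent ?N (mixed A B)"
      using y_CD[OF kl] Hc by - (rule cent_swap[OF N_sub], auto simp: cent_def)
    then show "y k l c d \<in> cent ?N (mixed A B)"
      by simp
  qed (rule CD)
  then have "mixed A B \<subseteq> cent ?N (mixed C D)"
    by (rule cent_swap[OF N_sub Hc])
  then show "commutator_subgroup G (mixed A B) (mixed C D) \<subseteq> ?N"
    by (intro commutator_subgroup_subset N_sub) (auto simp: cent_def)
qed

end

section \<open>Elementary matrices\<close>

lemma (in abelian_monoid) finsum_swap:
  assumes "finite S" "finite T" "\<And>i j. i \<in> S \<Longrightarrow> j \<in> T \<Longrightarrow> f i j \<in> carrier G"
  shows "(\<Oplus>i\<in>S. \<Oplus>j\<in>T. f i j) = (\<Oplus>j\<in>T. \<Oplus>i\<in>S. f i j)"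
  using assms(1,3)
proof (induction S rule: finite_induct)
  case (insert x S)
  have "(\<Oplus>j\<in>T. \<Oplus>i\<in>insert x S. f i j) = (\<Oplus>j\<in>T. f x j \<oplus> (\<Oplus>i\<in>S. f i j))"
    using insert by (intro finsum_cong') auto
  also have "\<dots> = (\<Oplus>j\<in>T. f x j) \<oplus> (\<Oplus>j\<in>T. \<Oplus>i\<in>S. f i j)"
    using insert.prems by (intro finsum_addf) auto
  finally show ?case
    using insert by simp
qed simp

section \<open>Entrywise matrix products and the Steinberg relations for transvections\<close>

context ring
begin

lemma matrix_mult_entry:
  "\<lbrakk>i \<in> {1..n}; j \<in> {1..n}\<rbrakk> \<Longrightarrow>
    (M \<otimes>\<^bsub>matrix_monoid R n\<^esub> N) (i, j) = (\<Oplus>k\<in>{1..n}. M (i, k) \<otimes> N (k, j))"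
  by (simp add: matrix_monoid_def)

lemma matrix_entry_closed:
  "\<lbrakk>M \<in> carrier (matrix_monoid R n); i \<in> {1..n}; j \<in> {1..n}\<rbrakk> \<Longrightarrow> M (i, j) \<in> carrier R"
  by (auto simp: matrix_monoid_def PiE_iff)

lemma matrix_eqI:
  assumes "M \<in> carrier (matrix_monoid R n)" "N \<in> carrier (matrix_monoid R n)"
    and "\<And>i j. \<lbrakk>i \<in> {1..n}; j \<in> {1..n}\<rbrakk> \<Longrightarrow> M (i, j) = N (i, j)"
  shows "M = N"
  using assms by (intro PiE_ext[of M "{1..n} \<times> {1..n}" "\<lambda>_. carrier R" N]) (auto simp: matrix_monoid_def)

lemma matrix_mult_closed:
  assumes "M \<in> carrier (matrix_monoid R n)" "N \<in> carrier (matrix_monoid R n)"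
  shows "M \<otimes>\<^bsub>matrix_monoid R n\<^esub> N \<in> carrier (matrix_monoid R n)"
  using assms matrix_entry_closed[of _ n] by (auto simp: matrix_monoid_def intro!: finsum_closed)

lemma matrix_one_entry:
  "\<lbrakk>i \<in> {1..n}; j \<in> {1..n}\<rbrakk> \<Longrightarrow> \<one>\<^bsub>matrix_monoid R n\<^esub> (i, j) = (if i = j then \<one> else \<zero>)"
  by (simp add: matrix_monoid_def)

lemma finsum_delta_left:
  assumes "finite S" "i \<in> S" "\<And>k. k \<in> S \<Longrightarrow> f k \<in> carrier R"
  shows "(\<Oplus>k\<in>S. (if i = k then \<one> else \<zero>) \<otimes> f k) = f i"
proof -
  have "(\<Oplus>k\<in>S. (if i = k then \<one> else \<zero>) \<otimes> f k) = (\<Oplus>k\<in>S. if i = k then f k else \<zero>)"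
    using assms by (intro finsum_cong') auto
  then show ?thesis
    using assms by (simp add: finsum_singleton Pi_def)
qed

lemma finsum_delta_right:
  assumes "finite S" "i \<in> S" "c \<in> carrier R" "\<And>k. k \<in> S \<Longrightarrow> f k \<in> carrier R"
  shows "(\<Oplus>k\<in>S. f k \<otimes> (if k = i then c else \<zero>)) = f i \<otimes> c"
proof -
  have "(\<Oplus>k\<in>S. f k \<otimes> (if k = i then c else \<zero>)) = (\<Oplus>k\<in>S. if i = k then f k \<otimes> c else \<zero>)"
    using assms by (intro finsum_cong') auto
  then show ?thesis
    using assms by (simp add: finsum_singleton Pi_def)
qed

text \<open>Associativity rests on distributivity and the interchange of two finite sums.\<close>

lemma matrix_monoid: "monoid (matrix_monoid R n)"
proof
  let ?M = "matrix_monoid R n"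
  fix L M N
  assume c: "L \<in> carrier ?M" "M \<in> carrier ?M" "N \<in> carrier ?M"
  note ent = c[THEN matrix_entry_closed]
  show "L \<otimes>\<^bsub>?M\<^esub> M \<otimes>\<^bsub>?M\<^esub> N = L \<otimes>\<^bsub>?M\<^esub> (M \<otimes>\<^bsub>?M\<^esub> N)"
  proof (rule matrix_eqI)
    fix i j assume ij: "i \<in> {1..n}" "j \<in> {1..n}"
    have "(L \<otimes>\<^bsub>?M\<^esub> M \<otimes>\<^bsub>?M\<^esub> N) (i, j)
        = (\<Oplus>k\<in>{1..n}. (\<Oplus>l\<in>{1..n}. L (i, l) \<otimes> M (l, k)) \<otimes> N (k, j))"
      using ij ent by (simp add: matrix_mult_entry del: atLeastAtMost_iff cong: finsum_cong)
    also have "\<dots> = (\<Oplus>k\<in>{1..n}. \<Oplus>l\<in>{1..n}. L (i, l) \<otimes> M (l, k) \<otimes> N (k, j))"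
      using ij ent by (intro finsum_cong' finsum_ldistr) (auto simp del: atLeastAtMost_iff)
    also have "\<dots> = (\<Oplus>l\<in>{1..n}. \<Oplus>k\<in>{1..n}. L (i, l) \<otimes> M (l, k) \<otimes> N (k, j))"
      using ij ent by (intro finsum_swap) (auto simp del: atLeastAtMost_iff)
    also have "\<dots> = (\<Oplus>l\<in>{1..n}. L (i, l) \<otimes> (\<Oplus>k\<in>{1..n}. M (l, k) \<otimes> N (k, j)))"
      using ij ent by (intro finsum_cong') (auto simp: finsum_rdistr m_assoc Pi_def simp del: atLeastAtMost_iff cong: finsum_cong)
    also have "\<dots> = (L \<otimes>\<^bsub>?M\<^esub> (M \<otimes>\<^bsub>?M\<^esub> N)) (i, j)"
      using ij ent by (simp add: matrix_mult_entry del: atLeastAtMost_iff cong: finsum_cong)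
    finally show "(L \<otimes>\<^bsub>?M\<^esub> M \<otimes>\<^bsub>?M\<^esub> N) (i, j) = (L \<otimes>\<^bsub>?M\<^esub> (M \<otimes>\<^bsub>?M\<^esub> N)) (i, j)" .
  qed (use c matrix_mult_closed in blast)+
next
  let ?M = "matrix_monoid R n"
  show one: "\<one>\<^bsub>?M\<^esub> \<in> carrier ?M"
    by (auto simp: matrix_monoid_def)
  fix L assume c: "L \<in> carrier ?M"
  note ent = c[THEN matrix_entry_closed]
  show "\<one>\<^bsub>?M\<^esub> \<otimes>\<^bsub>?M\<^esub> L = L"
  proof (rule matrix_eqI)
    fix i j assume ij: "i \<in> {1..n}" "j \<in> {1..n}"
    have "(\<one>\<^bsub>?M\<^esub> \<otimes>\<^bsub>?M\<^esub> L) (i, j) = (\<Oplus>k\<in>{1..n}. (if i = k then \<one> else \<zero>) \<otimes> L (k, j))"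
      using ij ent unfolding matrix_mult_entry[OF ij]
      by (intro finsum_cong') (auto simp: matrix_one_entry simp del: atLeastAtMost_iff)
    then show "(\<one>\<^bsub>?M\<^esub> \<otimes>\<^bsub>?M\<^esub> L) (i, j) = L (i, j)"
      using finsum_delta_left[of "{1..n}" i "\<lambda>k. L (k, j)"] ij ent by simp
  qed (use c one matrix_mult_closed in blast)+
  show "L \<otimes>\<^bsub>?M\<^esub> \<one>\<^bsub>?M\<^esub> = L"
  proof (rule matrix_eqI)
    fix i j assume ij: "i \<in> {1..n}" "j \<in> {1..n}"
    have "(L \<otimes>\<^bsub>?M\<^esub> \<one>\<^bsub>?M\<^esub>) (i, j) = (\<Oplus>k\<in>{1..n}. L (i, k) \<otimes> (if k = j then \<one> else \<zero>))"
      using ij ent unfolding matrix_mult_entry[OF ij]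
      by (intro finsum_cong') (auto simp: matrix_one_entry simp del: atLeastAtMost_iff)
    then show "(L \<otimes>\<^bsub>?M\<^esub> \<one>\<^bsub>?M\<^esub>) (i, j) = L (i, j)"
      using finsum_delta_right[of "{1..n}" j \<one> "\<lambda>k. L (i, k)"] ij ent by simp
  qed (use c one matrix_mult_closed in blast)+
qed (rule matrix_mult_closed)

lemma transvection_entry:
  "\<lbrakk>p \<in> {1..n}; q \<in> {1..n}\<rbrakk> \<Longrightarrow> transvection R n i j c (p, q)
     = (if p = q then \<one> else \<zero>) \<oplus> (if p = i \<and> q = j then c else \<zero>)"
  by (simp add: transvection_def)

lemma transvection_closed:
  "c \<in> carrier R \<Longrightarrow> transvection R n i j c \<in> carrier (matrix_monoid R n)"
  by (auto simp: matrix_monoid_def transvection_def)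

text \<open>Right multiplication by a transvection is a column operation. With this formula the
  relations below become comparisons of entries.\<close>

lemma mult_transvection_entry:
  assumes M: "M \<in> carrier (matrix_monoid R n)" and ij: "i \<in> {1..n}" "j \<in> {1..n}" and c: "c \<in> carrier R"
    and pq: "p \<in> {1..n}" "q \<in> {1..n}"
  shows "(M \<otimes>\<^bsub>matrix_monoid R n\<^esub> transvection R n i j c) (p, q)
    = (if q = j then M (p, q) \<oplus> M (p, i) \<otimes> c else M (p, q))"
proof -
  note ent = matrix_entry_closed[OF M]
  \<comment> \<open>The off-diagonal part of the transvection in column \<open>q\<close>; it sits in
    row \<open>i\<close>.\<close>
  let ?d = "if q = j then c else \<zero>"
  have "(M \<otimes>\<^bsub>matrix_monoid R n\<^esub> transvection R n i j c) (p, q)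
      = (\<Oplus>k\<in>{1..n}. M (p, k) \<otimes> (if k = q then \<one> else \<zero>) \<oplus> M (p, k) \<otimes> (if k = i then ?d else \<zero>))"
    unfolding matrix_mult_entry[OF pq] using pq ent c
    by (intro finsum_cong') (auto simp: transvection_entry r_distr simp del: atLeastAtMost_iff)
  also have "\<dots> = (\<Oplus>k\<in>{1..n}. M (p, k) \<otimes> (if k = q then \<one> else \<zero>))
      \<oplus> (\<Oplus>k\<in>{1..n}. M (p, k) \<otimes> (if k = i then ?d else \<zero>))"
    using pq ent c by (intro finsum_addf) (auto simp del: atLeastAtMost_iff)
  also have "\<dots> = M (p, q) \<oplus> M (p, i) \<otimes> ?d"
    using pq ij ent c finsum_delta_right[of "{1..n}" q \<one> "\<lambda>k. M (p, k)"]
      finsum_delta_right[of "{1..n}" i ?d "\<lambda>k. M (p, k)"] by simp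
  finally show ?thesis
    using pq ij ent by simp
qed

lemmas transvection_simps = mult_transvection_entry matrix_mult_closed transvection_closed transvection_entry
  matrix_one_entry

lemma transvection_add:
  assumes "i \<in> {1..n}" "j \<in> {1..n}" "i \<noteq> j" "a \<in> carrier R" "b \<in> carrier R"
  shows "transvection R n i j (a \<oplus> b) = transvection R n i j a \<otimes>\<^bsub>matrix_monoid R n\<^esub> transvection R n i j b"
  using assms by (intro matrix_eqI[of _ n]) (auto simp: transvection_simps simp del: atLeastAtMost_iff)

lemma transvection_zero:
  "transvection R n i j \<zero> = \<one>\<^bsub>matrix_monoid R n\<^esub>"
  by (auto simp: matrix_monoid_def transvection_def)

text \<open>Stated in the form x y = c y x that \<open>commutator_eqI\<close> expects.\<close>

lemma transvection_mult_left:
  assumes "i \<in> {1..n}" "j \<in> {1..n}" "k \<in> {1..n}" "i \<noteq> j" "i \<noteq> k" "j \<noteq> k" "a \<in> carrier R" "b \<in> carrier R"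
  shows "transvection R n i j a \<otimes>\<^bsub>matrix_monoid R n\<^esub> transvection R n j k b
    = transvection R n i k (a \<otimes> b) \<otimes>\<^bsub>matrix_monoid R n\<^esub> transvection R n j k b
        \<otimes>\<^bsub>matrix_monoid R n\<^esub> transvection R n i j a"
  using assms by (intro matrix_eqI[of _ n]) (auto simp: transvection_simps simp del: atLeastAtMost_iff)

lemma transvection_commute:
  assumes "i \<in> {1..n}" "j \<in> {1..n}" "k \<in> {1..n}" "l \<in> {1..n}" "i \<noteq> j" "k \<noteq> l" "i \<noteq> l" "j \<noteq> k"
    "a \<in> carrier R" "b \<in> carrier R"
  shows "transvection R n i j a \<otimes>\<^bsub>matrix_monoid R n\<^esub> transvection R n k l b
    = transvection R n k l b \<otimes>\<^bsub>matrix_monoid R n\<^esub> transvection R n i j a"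
  using assms by (intro matrix_eqI[of _ n]) (auto simp: transvection_simps a_ac simp del: atLeastAtMost_iff)

section \<open>The general linear group and the transfer of the abstract result\<close>

lemma GL_group: "group (GL n R)"
  unfolding GL_def using matrix_monoid by (rule monoid.units_group)

lemma GL_mult: "monoid.mult (GL n R) = monoid.mult (matrix_monoid R n)"
  by (simp add: GL_def units_of_mult)

lemma transvection_GL:
  assumes "i \<in> {1..n}" "j \<in> {1..n}" "i \<noteq> j" "c \<in> carrier R"
  shows "transvection R n i j c \<in> carrier (GL n R)"
proof -
  have "transvection R n i j c \<otimes>\<^bsub>matrix_monoid R n\<^esub> transvection R n i j (\<ominus> c) = \<one>\<^bsub>matrix_monoid R n\<^esub>"
    "transvection R n i j (\<ominus> c) \<otimes>\<^bsub>matrix_monoid R n\<^esub> transvection R n i j c = \<one>\<^bsub>matrix_monoid R n\<^esub>"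
    using assms by (simp_all add: r_neg l_neg transvection_zero flip: transvection_add)
  then show ?thesis
    unfolding GL_def units_of_carrier Units_def using assms(4) transvection_closed by blast
qed

end

theorem lemma8:
  fixes R :: "('a, 'b) ring_scheme" and n :: nat and A B C D :: "'a set"
  assumes "ring R" and "n \<ge> 4"
    and "ideal A R" and "ideal B R" and "ideal C R" and "ideal D R"
  shows "commutator_subgroup (GL n R)
           (commutator_subgroup (GL n R) (elementary_subgroup R n A) (elementary_subgroup R n B))
           (commutator_subgroup (GL n R) (elementary_subgroup R n C) (elementary_subgroup R n D))
       = commutator_subgroup (GL n R)
           (elementary_subgroup R n (symm_prod R A B))
           (elementary_subgroup R n (symm_prod R C D))"
proof -
  interpret R: ring R by fact
  interpret GL: group "GL n R" by (rule R.GL_group)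
  let ?T = "\<lambda>A. {transvection R n i j a | i j a. i \<in> {1..n} \<and> j \<in> {1..n} \<and> i \<noteq> j \<and> a \<in> A}"
  \<comment> \<open>The abstract result is applied inside E(n, R), which is generated by
    transvections as the locale requires.\<close>
  define E where "E = elementary_subgroup R n (carrier R)"
  have T: "?T (carrier R) \<subseteq> carrier (GL n R)"
    using R.transvection_GL by blast
  have E: "subgroup E (GL n R)"
    unfolding E_def elementary_subgroup_def using T by (rule GL.generate_is_subgroup)
  have TE: "transvection R n i j a \<in> E" if "i \<in> {1..n}" "j \<in> {1..n}" "i \<noteq> j" "a \<in> carrier R" for i j a
    unfolding E_def elementary_subgroup_def using that by (intro generate.incl) blast
  have comm: "commutator (GL n R) (transvection R n i j a) (transvection R n j k b) = transvection R n i k (a \<otimes>\<^bsub>R\<^esub> b)"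
    if "i \<in> {1..n}" "j \<in> {1..n}" "k \<in> {1..n}" "i \<noteq> j" "i \<noteq> k" "j \<noteq> k" "a \<in> carrier R" "b \<in> carrier R"
    for i j k a b
    using that R.transvection_mult_left[OF that]
    by (intro GL.commutator_eqI R.transvection_GL) (simp_all add: R.GL_mult)
  have comm_one: "commutator (GL n R) (transvection R n i j a) (transvection R n k l b) = \<one>\<^bsub>GL n R\<^esub>"
    if "i \<in> {1..n}" "j \<in> {1..n}" "k \<in> {1..n}" "l \<in> {1..n}" "i \<noteq> j" "k \<noteq> l" "i \<noteq> l" "j \<noteq> k"
      "a \<in> carrier R" "b \<in> carrier R" for i j k l a b
    using that R.transvection_commute[OF that]
    by (subst GL.commutator_eq_one_iff) (simp_all add: R.transvection_GL R.GL_mult del: atLeastAtMost_iff)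
  let ?G = "(GL n R)\<lparr>carrier := E\<rparr>"
  interpret S: steinberg ?G R "{1..n}" "transvection R n"
  proof (intro steinberg.intro steinberg_axioms.intro)
    show "group ?G"
      using E by (rule GL.subgroup_imp_group)
    show "ring R" by fact
    show "4 \<le> card {1..n}"
      using assms(2) by simp
    show "carrier ?G = generate ?G (?T (carrier R))"
      using GL.generate_consistent[OF _ E, of "?T (carrier R)"] TE
      by (auto simp: E_def elementary_subgroup_def)
  qed (use TE R.transvection_add comm comm_one in
      \<open>simp_all add: GL.commutator_consistent[OF E] R.GL_mult del: atLeastAtMost_iff\<close>)
  have El: "elementary_subgroup R n K = S.El K" "S.El K \<subseteq> E" if "ideal K R" for K
  proof -
    have "?T K \<subseteq> E"
      using TE ideal.Icarr[OF that] by blast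
    then show "elementary_subgroup R n K = S.El K"
      unfolding elementary_subgroup_def S.El_def using E by (rule GL.generate_consistent[symmetric])
    show "S.El K \<subseteq> E"
      using S.El_subset[OF that] by simp
  qed
  have mixed: "S.mixed K L = commutator_subgroup (GL n R) (elementary_subgroup R n K) (elementary_subgroup R n L)"
      "S.mixed K L \<subseteq> E" if "ideal K R" "ideal L R" for K L
    using GL.commutator_subgroup_consistent[OF E El(2)[OF that(1)] El(2)[OF that(2)]]
    by (simp_all only: El(1) that)
  \<comment> \<open>All subgroups involved lie in \<open>E\<close>, so commutator subgroups formed
    in \<open>E\<close> and in GL(n, R) agree.\<close>
  have "commutator_subgroup (GL n R) (S.mixed A B) (S.mixed C D)
      = commutator_subgroup ?G (S.mixed A B) (S.mixed C D)"
    using E by (rule GL.commutator_subgroup_consistent(1)[symmetric]) (intro mixed(2) assms)+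
  also have "\<dots> = S.mixed (symm_prod R A B) (symm_prod R C D)"
    using assms by (intro S.mixed_mixed)
  finally show ?thesis
    by (simp only: mixed(1) assms R.symm_prod_ideal)
qed

end
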